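(* Let $G$ be a connected graph with vertex set $X$ ($|X|\ge 2$). The following are equivalent: (i) $G$ is Ptolemaic; (ii) the underlying undirected graph of $H(K(G))$ is acyclic; (iii) $N(K(G))$ is arboreal; (iv) $G$ is arboreal representable; (v) $G$ is represented by some arboreal network on $X$ with $\mathrm{ecc}(G)=|K(G)|$ roots.
   Context: A graph is Ptolemaic if its shortest-path distance $d^*$ satisfies $d^*(x,y)d^*(z,u)+d^*(x,u)d^*(y,z)\ge d^*(x,z)d^*(y,u)$ for all vertices $x,y,z,u$. A clique is a set $Y$ of vertices with $|Y|\ge2$ that are pairwise adjacent; $K(G)$ is the set of maximal cliques of $G$. An edge clique cover of $G$ is a set $K$ of cliques of $G$ such that every edge of $G$ is contained in some member of $K$; $\mathrm{ecc}(G)$ is the minimum size of an edge clique cover. In a digraph, a leaf is a vertex of indegree 1 and outdegree 0, a root is a vertex of indegree 0. A network on $X$ is a simple acyclic digraph $N$ whose underlying undirected graph is connected, whose set of leaves is $X$, in which every vertex of indegree 0 has outdegree at least 2, every vertex of outdegree 0 has indegree 1, and no vertex has both indegree and outdegree equal to 1. $N$ is arboreal if its underlying undirected graph is a tree. Leaves $x\ne y$ share an ancestor if some vertex has directed paths (possibly of length 0) to both. The shared ancestry graph $\mathcal A(N)$ has vertex set $X$, distinct $x,y$ adjacent iff they share an ancestor in $N$. $N$ represents $G$ if $\mathcal A(N)=G$ (same edge set on $X$); $G$ is arboreal representable if some arboreal network on $X$ represents it. For a set $\mathcal C$ of non-empty subsets of $X$, the cover digraph $H(\mathcal C)$ has vertex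 set $\mathcal C$ and an arc $(A,B)$ iff $B\subsetneq A$ and no $C\in\mathcal C$ satisfies $B\subsetneq C\subsetneq A$. The digraph $N(\mathcal C)$ is obtained from $H(\mathcal C)$ by: adding, for each $x\in X$ with $\{x\}\notin\mathcal C$, a new vertex $\{x\}$ of outdegree 0, and an arc from each vertex $A$ of $H(\mathcal C)$ to $\{x\}$ whenever $x\in A$ and no child of $A$ in $H(\mathcal C)$ contains $x$; then adding a new child to every vertex of outdegree 0 and indegree at least 2; then identifying each leaf $l$ with the unique $x\in X$ such that $l=\{x\}$ or $l$ is the child of $\{x\}$. For a set $K$ of cliques, $\mathcal C(K)=\{\bigcap_{Y\in S}Y : \emptyset\ne S\subseteq K,\ \bigcap_{Y\in S}Y\ne\emptyset\}$ and $N(K)=N(\mathcal C(K))$.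
   Formalization: In (ii), H(K(G)) is taken as H(C(K(G))), the cover digraph of all non-empty intersections of maximal cliques, parallel to N(K)=N(C(K)); read literally, H of the antichain K(G) has no arcs and the equivalence fails, e.g. for the 4-cycle. *)

theory Defs
  imports "Graph_Theory.Graph_Theory"
begin

text \<open>
  Undirected graphs are symmetric loop-free digraphs (\<^locale>\<open>pair_graph\<close>, which includes
  finiteness): \<open>u\<close> and \<open>v\<close> are adjacent iff \<open>(u, v) \<in> parcs G\<close>.
\<close>

section \<open>Ptolemaic graphs and cliques\<close>

text \<open>
  The shortest-path distance is the library's \<open>\<mu>\<close> with unit weights. It takes values in the
  extended reals, but is finite between any two vertices of a connected graph.
\<close>

definition graph_dist :: "'a pair_pre_digraph \<Rightarrow> 'a \<Rightarrow> 'a \<Rightarrow> ereal" where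
  "graph_dist G u v = wf_digraph.\<mu> (with_proj G) (\<lambda>_. 1) u v"

definition ptolemaic :: "'a pair_pre_digraph \<Rightarrow> bool" where
  "ptolemaic G \<longleftrightarrow>
    (\<forall>x\<in>pverts G. \<forall>y\<in>pverts G. \<forall>z\<in>pverts G. \<forall>u\<in>pverts G.
      graph_dist G x y * graph_dist G z u + graph_dist G x u * graph_dist G y z
        \<ge> graph_dist G x z * graph_dist G y u)"

definition is_clique :: "'a pair_pre_digraph \<Rightarrow> 'a set \<Rightarrow> bool" where
  "is_clique G Y \<longleftrightarrow>
    Y \<subseteq> pverts G \<and> 2 \<le> card Y \<and> pairwise (\<lambda>u v. (u, v) \<in> parcs G) Y"

definition max_cliques :: "'a pair_pre_digraph \<Rightarrow> 'a set set" where
  "max_cliques G = {Y. is_clique G Y \<and> (\<forall>Z. is_clique G Z \<longrightarrow> Y \<subseteq> Z \<longrightarrow> Z = Y)}"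

definition edge_clique_cover :: "'a pair_pre_digraph \<Rightarrow> 'a set set \<Rightarrow> bool" where
  "edge_clique_cover G K \<longleftrightarrow>
    (\<forall>Y\<in>K. is_clique G Y) \<and> (\<forall>(u, v)\<in>parcs G. \<exists>Y\<in>K. u \<in> Y \<and> v \<in> Y)"

definition ecc :: "'a pair_pre_digraph \<Rightarrow> nat" where
  "ecc G = (LEAST n. \<exists>K. edge_clique_cover G K \<and> finite K \<and> card K = n)"

section \<open>Underlying undirected graphs\<close>

text \<open>
  The library's \<^const>\<open>forest\<close> and \<^const>\<open>tree\<close> forbid directed cycles. In the symmetric digraph
  \<^const>\<open>mk_symmetric\<close> every edge gives a directed cycle of length 2; the cycles of the
  underlying undirected simple graph are those of length at least 3.
\<close>

definition undirected_acyclic :: "'v pair_pre_digraph \<Rightarrow> bool" where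
  "undirected_acyclic D \<longleftrightarrow>
    \<not> (\<exists>p. pre_digraph.cycle (with_proj (mk_symmetric (with_proj D))) p \<and> 3 \<le> length p)"

definition undirected_tree :: "'v pair_pre_digraph \<Rightarrow> bool" where
  "undirected_tree D \<longleftrightarrow> Digraph_Component.connected (with_proj D) \<and> undirected_acyclic D"

section \<open>Networks\<close>

definition leaves :: "'v pair_pre_digraph \<Rightarrow> 'v set" where
  "leaves D =
    {v \<in> pverts D. in_degree (with_proj D) v = 1 \<and> out_degree (with_proj D) v = 0}"

definition roots :: "'v pair_pre_digraph \<Rightarrow> 'v set" where
  "roots D = {v \<in> pverts D. in_degree (with_proj D) v = 0}"

text \<open>
  The vertices of a network have type \<open>'a + 'b\<close>: an element \<open>x\<close> of \<open>X\<close> is the vertex \<open>Inl x\<close>,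
  and \<open>'b\<close> supplies the names of further vertices.
\<close>

definition network_on :: "'a set \<Rightarrow> ('a + 'b) pair_pre_digraph \<Rightarrow> bool" where
  "network_on X N \<longleftrightarrow>
    pair_digraph N \<and> acyclic (parcs N) \<and> Digraph_Component.connected (with_proj N) \<and>
    leaves N = Inl ` X \<and>
    (\<forall>v\<in>pverts N. in_degree (with_proj N) v = 0 \<longrightarrow> 2 \<le> out_degree (with_proj N) v) \<and>
    (\<forall>v\<in>pverts N. out_degree (with_proj N) v = 0 \<longrightarrow> in_degree (with_proj N) v = 1) \<and>
    (\<forall>v\<in>pverts N. \<not> (in_degree (with_proj N) v = 1 \<and> out_degree (with_proj N) v = 1))"

definition arboreal :: "'v pair_pre_digraph \<Rightarrow> bool" where
  "arboreal N \<longleftrightarrow> undirected_tree N"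

definition share_ancestor :: "'v pair_pre_digraph \<Rightarrow> 'v \<Rightarrow> 'v \<Rightarrow> bool" where
  "share_ancestor N u v \<longleftrightarrow>
    (\<exists>w\<in>pverts N. w \<rightarrow>\<^sup>*\<^bsub>with_proj N\<^esub> u \<and> w \<rightarrow>\<^sup>*\<^bsub>with_proj N\<^esub> v)"

definition shared_ancestry_graph ::
    "'a set \<Rightarrow> ('a + 'b) pair_pre_digraph \<Rightarrow> 'a pair_pre_digraph" where
  "shared_ancestry_graph X N =
    \<lparr> pverts = X,
      parcs = {(x, y). x \<in> X \<and> y \<in> X \<and> x \<noteq> y \<and> share_ancestor N (Inl x) (Inl y)} \<rparr>"

definition represents :: "'a set \<Rightarrow> ('a + 'b) pair_pre_digraph \<Rightarrow> 'a pair_pre_digraph \<Rightarrow> bool" where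
  "represents X N G \<longleftrightarrow> shared_ancestry_graph X N = G"

text \<open>
  Networks are finite, so up to renaming the vertices outside \<open>X\<close> every network on \<open>X\<close> has
  its vertices in \<open>'a + nat\<close>.
\<close>

definition arboreal_representable :: "'a set \<Rightarrow> 'a pair_pre_digraph \<Rightarrow> bool" where
  "arboreal_representable X G \<longleftrightarrow>
    (\<exists>N :: ('a + nat) pair_pre_digraph. network_on X N \<and> arboreal N \<and> represents X N G)"

section \<open>The cover digraph and the network of a set system\<close>

definition cover_digraph :: "'a set set \<Rightarrow> 'a set pair_pre_digraph" where
  "cover_digraph C =
    \<lparr> pverts = C,
      parcs = {(A, B). A \<in> C \<and> B \<in> C \<and> B \<subset> A \<and> \<not> (\<exists>D\<in>C. B \<subset> D \<and> D \<subset> A)} \<rparr>"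

definition add_singletons :: "'a set \<Rightarrow> 'a set set \<Rightarrow> 'a set pair_pre_digraph" where
  "add_singletons X C =
    \<lparr> pverts = C \<union> {{x} | x. x \<in> X \<and> {x} \<notin> C},
      parcs = parcs (cover_digraph C) \<union>
        {(A, {x}) | A x. A \<in> C \<and> x \<in> X \<and> {x} \<notin> C \<and> x \<in> A \<and>
          \<not> (\<exists>B. (A, B) \<in> parcs (cover_digraph C) \<and> x \<in> B)} \<rparr>"

text \<open>\<open>Inl v\<close> is the original vertex \<open>v\<close>, and \<open>Inr v\<close> the new child of \<open>v\<close>.\<close>

definition add_children :: "'v pair_pre_digraph \<Rightarrow> ('v + 'v) pair_pre_digraph" where
  "add_children D =
    (let S = {v \<in> pverts D. out_degree (with_proj D) v = 0 \<and> 2 \<le> in_degree (with_proj D) v}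
     in \<lparr> pverts = Inl ` pverts D \<union> Inr ` S,
          parcs = map_prod Inl Inl ` parcs D \<union> {(Inl v, Inr v) | v. v \<in> S} \<rparr>)"

text \<open>
  A leaf becomes \<open>Inl x\<close> for the corresponding \<open>x \<in> X\<close>. The new children are all leaves, so any
  other vertex is of the form \<open>Inl A\<close> and becomes \<open>Inr A\<close>.
\<close>

definition leaf_label ::
    "'a set \<Rightarrow> ('a set + 'a set) pair_pre_digraph \<Rightarrow> 'a set + 'a set \<Rightarrow> 'a + 'a set" where
  "leaf_label X D v =
    (if v \<in> leaves D
     then Inl (THE x. x \<in> X \<and> (v = Inl {x} \<or> (Inl {x}, v) \<in> parcs D))
     else Inr (projl v))"

definition identify_leaves ::
    "'a set \<Rightarrow> ('a set + 'a set) pair_pre_digraph \<Rightarrow> ('a + 'a set) pair_pre_digraph" where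
  "identify_leaves X D =
    \<lparr> pverts = leaf_label X D ` pverts D,
      parcs = map_prod (leaf_label X D) (leaf_label X D) ` parcs D \<rparr>"

definition set_network :: "'a set \<Rightarrow> 'a set set \<Rightarrow> ('a + 'a set) pair_pre_digraph" where
  "set_network X C = identify_leaves X (add_children (add_singletons X C))"

definition intersections :: "'a set set \<Rightarrow> 'a set set" where
  "intersections K = {\<Inter>S | S. S \<noteq> {} \<and> S \<subseteq> K \<and> \<Inter>S \<noteq> {}}"

text \<open>
  For a set \<open>K\<close> of cliques, \<open>H(K)\<close> and \<open>N(K)\<close> are taken of the set system \<^term>\<open>intersections K\<close>.
  (The cover digraph of the antichain of maximal cliques itself would have no arcs.)
\<close>

definition clique_cover_digraph :: "'a set set \<Rightarrow> 'a set pair_pre_digraph" where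
  "clique_cover_digraph K = cover_digraph (intersections K)"

definition clique_network :: "'a set \<Rightarrow> 'a set set \<Rightarrow> ('a + 'a set) pair_pre_digraph" where
  "clique_network X K = set_network X (intersections K)"

end

theory Submission
  imports Defs
begin

text \<open>
  An arboreal network represents only Ptolemaic graphs: the shared ancestry relation on all vertices
  of an oriented tree defines a graph in which the leaves are isometrically embedded (replace each
  vertex of a path by a leaf below it), and attaching a pendant vertex to the tree extends this graph
  by a pendant vertex, a true twin, or a false twin of a simplicial vertex. Each of these operations
  preserves the Ptolemaic inequality.

  Conversely, in a Ptolemaic graph induced paths are geodesic and there are no gems. Hence two
  intersecting maximal cliques \<open>M\<close>, \<open>Q\<close> are separated by \<open>M \<inter> Q\<close>, and the intersections of maximal
  cliques inside a given maximal clique form a laminar family. A cycle in the cover digraph would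
  contradict the separation property at its smallest member. The network of the maximal cliques
  arises from the cover digraph by attaching pendant vertices, and laminarity provides every maximal
  clique with an edge that lies in no other one, so that no edge clique cover has fewer members.
\<close>

section \<open>Walks, cycles and degrees as properties of the arc relation\<close>

definition rel_cycle :: "'v rel \<Rightarrow> 'v list \<Rightarrow> bool" where
  "rel_cycle E xs \<longleftrightarrow> 3 \<le> length xs \<and> distinct xs \<and>
    successively (\<lambda>a b. (a, b) \<in> E) xs \<and> (last xs, hd xs) \<in> E"

lemma symcl_iff [simp]: "(a, b) \<in> symcl R \<longleftrightarrow> (a, b) \<in> R \<or> (b, a) \<in> R"
  by (force simp: symcl_def)

lemma parcs_mk_symmetric_with_proj: "parcs (mk_symmetric (with_proj D)) = symcl (parcs D)"
  by (auto simp: parcs_mk_symmetric; metis fst_conv snd_conv)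

lemma pcas_zip_tl:
  "xs \<noteq> [] \<Longrightarrow> pcas (hd xs) (zip xs (tl xs @ [v])) v"
proof (induction xs)
  case (Cons a xs)
  then show ?case by (cases xs) auto
qed simp

lemma set_zip_tl:
  "xs \<noteq> [] \<Longrightarrow> successively (\<lambda>a b. (a, b) \<in> E) xs \<Longrightarrow> (last xs, v) \<in> E \<Longrightarrow>
    set (zip xs (tl xs @ [v])) \<subseteq> E"
proof (induction xs)
  case (Cons a xs)
  then show ?case by (cases xs) auto
qed simp

lemma pcas_successively:
  "p \<noteq> [] \<Longrightarrow> pcas u p v \<Longrightarrow> set p \<subseteq> E \<Longrightarrow>
    hd (map fst p) = u \<and> successively (\<lambda>a b. (a, b) \<in> E) (map fst p) \<and> (last (map fst p), v) \<in> E"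
proof (induction p arbitrary: u)
  case (Cons e p)
  then show ?case by (cases p) auto
qed simp

lemma undirected_acyclic_iff:
  assumes "pair_wf_digraph D"
  shows "undirected_acyclic D \<longleftrightarrow> \<not> (\<exists>xs. rel_cycle (symcl (parcs D)) xs)"
proof -
  interpret D: pair_wf_digraph D by fact
  let ?M = "mk_symmetric (with_proj D)"
  interpret M: pair_wf_digraph ?M ..
  have "(\<exists>p. M.cycle p \<and> 3 \<le> length p) \<longleftrightarrow> (\<exists>xs. rel_cycle (symcl (parcs D)) xs)"
  proof
    assume "\<exists>p. M.cycle p \<and> 3 \<le> length p"
    then obtain p u where p: "M.awalk u p u" "distinct (tl (pawalk_verts u p))" "p \<noteq> []"
      "3 \<le> length p"
      by (auto simp: M.cycle_def)
    have arcs: "set p \<subseteq> symcl (parcs D)" and cas: "pcas u p u"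
      using p(1) by (auto simp: M.awalk_def parcs_mk_symmetric_with_proj)
    have succ: "hd (map fst p) = u" "successively (\<lambda>a b. (a, b) \<in> symcl (parcs D)) (map fst p)"
      "(last (map fst p), u) \<in> symcl (parcs D)"
      using pcas_successively[OF p(3) cas arcs] by auto
    have "pawalk_verts u p = map fst p @ [snd (last p)]"
      using M.awalk_verts_conv[of u p] p(3) by simp
    moreover have "last (pawalk_verts u p) = u"
      using p(1) by auto
    ultimately have "pawalk_verts u p = map fst p @ [u]" by simp
    then have "distinct (map fst p)"
      using p(2,3) succ(1) by (cases p) auto
    then have "rel_cycle (symcl (parcs D)) (map fst p)"
      unfolding rel_cycle_def using succ p(4) by auto
    then show "\<exists>xs. rel_cycle (symcl (parcs D)) xs" ..
  next
    assume "\<exists>xs. rel_cycle (symcl (parcs D)) xs"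
    then obtain xs where xs: "3 \<le> length xs" "distinct xs"
      "successively (\<lambda>a b. (a, b) \<in> symcl (parcs D)) xs" "(last xs, hd xs) \<in> symcl (parcs D)"
      by (auto simp: rel_cycle_def)
    then have ne: "xs \<noteq> []" by auto
    define p where "p = zip xs (tl xs @ [hd xs])"
    have len: "length p = length xs" using ne by (auto simp: p_def)
    have set: "set p \<subseteq> parcs ?M"
      unfolding p_def parcs_mk_symmetric_with_proj by (rule set_zip_tl[OF ne xs(3,4)])
    have cas: "pcas (hd xs) p (hd xs)" unfolding p_def by (rule pcas_zip_tl[OF ne])
    have "(last xs, hd xs) \<in> parcs ?M" using xs(4) by (simp only: parcs_mk_symmetric_with_proj)
    then have awalk: "M.awalk (hd xs) p (hd xs)"
      unfolding M.awalk_def using set cas M.in_arcsD2 by auto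
    have "p \<noteq> []" using len xs(1) by auto
    have "pawalk_verts (hd xs) p = fst (hd p) # map snd p"
      using M.awalk_verts_conv'[OF cas] \<open>p \<noteq> []\<close> by simp
    then have "tl (pawalk_verts (hd xs) p) = map snd p" by simp
    also have "\<dots> = tl xs @ [hd xs]" unfolding p_def using ne by simp
    finally have "distinct (tl (pawalk_verts (hd xs) p))" using xs(2) ne by (cases xs) auto
    then have "M.cycle p" unfolding M.cycle_def using awalk \<open>p \<noteq> []\<close> by auto
    then show "\<exists>p. M.cycle p \<and> 3 \<le> length p" using len xs(1) by auto
  qed
  then show ?thesis by (simp add: undirected_acyclic_def)
qed

lemma reachable_iff_rtrancl:
  assumes "pair_wf_digraph D"
  shows "u \<rightarrow>\<^sup>*\<^bsub>with_proj D\<^esub> v \<longleftrightarrow> u \<in> pverts D \<and> (u, v) \<in> (parcs D)\<^sup>*"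
proof
  assume "u \<rightarrow>\<^sup>*\<^bsub>with_proj D\<^esub> v"
  then have "(u, v) \<in> rtrancl_on (pverts D) (parcs D)" by (simp add: reachable_def)
  then show "u \<in> pverts D \<and> (u, v) \<in> (parcs D)\<^sup>*" by induction auto
next
  assume "u \<in> pverts D \<and> (u, v) \<in> (parcs D)\<^sup>*"
  then have "(u, v) \<in> (parcs D)\<^sup>*" "u \<in> pverts D" by auto
  then have "(u, v) \<in> rtrancl_on (pverts D) (parcs D)"
    by induction (auto intro: rtrancl_on_into_rtrancl_on dest: pair_wf_digraph.in_arcsD2[OF assms])
  then show "u \<rightarrow>\<^sup>*\<^bsub>with_proj D\<^esub> v" by (simp add: reachable_def)
qed

lemma connected_iff_rtrancl:
  assumes "pair_wf_digraph D"
  shows "Digraph_Component.connected (with_proj D) \<longleftrightarrow>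
    pverts D \<noteq> {} \<and> (\<forall>u\<in>pverts D. \<forall>v\<in>pverts D. (u, v) \<in> (symcl (parcs D))\<^sup>*)"
proof -
  interpret D: pair_wf_digraph D by fact
  have "pair_wf_digraph (mk_symmetric (with_proj D))" ..
  from reachable_iff_rtrancl[OF this] show ?thesis
    by (auto simp: Digraph_Component.connected_def strongly_connected_def
        parcs_mk_symmetric_with_proj)
qed

lemma in_degree_with_proj: "in_degree (with_proj D) v = card {u. (u, v) \<in> parcs D}"
proof -
  have "in_arcs (with_proj D) v = (\<lambda>u. (u, v)) ` {u. (u, v) \<in> parcs D}"
    by (auto simp: in_arcs_def)
  then show ?thesis by (simp add: in_degree_def card_image inj_on_def)
qed

lemma out_degree_with_proj: "out_degree (with_proj D) v = card {w. (v, w) \<in> parcs D}"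
proof -
  have "out_arcs (with_proj D) v = (\<lambda>w. (v, w)) ` {w. (v, w) \<in> parcs D}"
    by (auto simp: out_arcs_def)
  then show ?thesis by (simp add: out_degree_def card_image inj_on_def)
qed

section \<open>The distance of a connected graph\<close>

definition rel_dist :: "'v rel \<Rightarrow> 'v \<Rightarrow> 'v \<Rightarrow> nat" where
  "rel_dist E x y = (LEAST n. (x, y) \<in> E ^^ n)"

lemma awalk_of_relpow:
  assumes "pair_wf_digraph G" "u \<in> pverts G" "(u, v) \<in> parcs G ^^ n"
  shows "\<exists>p. pre_digraph.awalk (with_proj G) u p v \<and> length p = n"
proof -
  interpret G: pair_wf_digraph G by fact
  show ?thesis using assms(2,3)
  proof (induction n arbitrary: u)
    case 0
    then show ?case by (auto intro: exI[of _ "[]"] simp: G.awalk_Nil_iff)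
  next
    case (Suc n)
    then obtain w where w: "(u, w) \<in> parcs G" "(w, v) \<in> parcs G ^^ n"
      by (meson relpow_Suc_D2)
    then obtain p where "G.awalk w p v" "length p = n"
      using Suc.IH[of w] G.in_arcsD2 by blast
    then show ?case using w by (intro exI[of _ "(u, w) # p"]) (auto simp: G.awalk_Cons_iff)
  qed
qed

lemma relpow_of_awalk:
  assumes "pair_wf_digraph G" "pre_digraph.awalk (with_proj G) u p v"
  shows "(u, v) \<in> parcs G ^^ length p"
proof -
  interpret G: pair_wf_digraph G by fact
  show ?thesis using assms(2)
  proof (induction p arbitrary: u)
    case (Cons e p)
    then show ?case by (cases e) (auto simp: G.awalk_Cons_iff intro: relpow_Suc_I2 simp del: relpow.simps)
  qed (auto simp: G.awalk_Nil_iff)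
qed

lemma rel_dist_le: "(x, y) \<in> E ^^ n \<Longrightarrow> rel_dist E x y \<le> n"
  unfolding rel_dist_def by (rule Least_le)

lemma relpow_rel_dist: "(x, y) \<in> E\<^sup>* \<Longrightarrow> (x, y) \<in> E ^^ rel_dist E x y"
  unfolding rel_dist_def by (rule LeastI_ex) (auto simp: rtrancl_power)

lemma graph_dist_eq_rel_dist:
  assumes "pair_wf_digraph G" "u \<in> pverts G" "(u, v) \<in> (parcs G)\<^sup>*"
  shows "graph_dist G u v = ereal (real (rel_dist (parcs G) u v))"
proof -
  interpret G: pair_wf_digraph G by fact
  have cost: "G.awalk_cost (\<lambda>_. 1) p = real (length p)" for p
    by (induction p) auto
  have "G.\<mu> (\<lambda>_. 1) u v = ereal (real (rel_dist (parcs G) u v))"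
  proof (rule antisym)
    obtain p where "G.awalk u p v" "length p = rel_dist (parcs G) u v"
      using awalk_of_relpow[OF assms(1,2) relpow_rel_dist[OF assms(3)]] by blast
    then show "G.\<mu> (\<lambda>_. 1) u v \<le> ereal (real (rel_dist (parcs G) u v))"
      using G.min_cost_le_walk_cost[of u p v "\<lambda>_. 1"] by (simp add: cost)
  next
    show "ereal (real (rel_dist (parcs G) u v)) \<le> G.\<mu> (\<lambda>_. 1) u v"
      unfolding G.\<mu>_def
      by (rule INF_greatest) (auto simp: cost intro!: rel_dist_le relpow_of_awalk[OF assms(1)])
  qed
  then show ?thesis by (simp add: graph_dist_def)
qed

definition ptol :: "('v \<Rightarrow> 'v \<Rightarrow> nat) \<Rightarrow> 'v \<Rightarrow> 'v \<Rightarrow> 'v \<Rightarrow> 'v \<Rightarrow> bool" where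
  "ptol d x y z u \<longleftrightarrow> d x z * d y u \<le> d x y * d z u + d x u * d y z"

lemma ptolemaic_iff_rel_dist:
  assumes "pair_graph G" "Digraph_Component.connected (with_proj G)"
  shows "ptolemaic G \<longleftrightarrow> (\<forall>x\<in>pverts G. \<forall>y\<in>pverts G. \<forall>z\<in>pverts G. \<forall>u\<in>pverts G.
    ptol (rel_dist (parcs G)) x y z u)"
proof -
  interpret G: pair_graph G by fact
  have wf: "pair_wf_digraph G" by unfold_locales
  have "symcl (parcs G) = parcs G"
    using G.sym_arcs by (auto simp: symmetric_def sym_def)
  then have conn: "(u, v) \<in> (parcs G)\<^sup>*" if "u \<in> pverts G" "v \<in> pverts G" for u v
    using assms(2) that by (simp add: connected_iff_rtrancl[OF wf])
  let ?d = "rel_dist (parcs G)"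
  have "ereal (real a) * ereal (real b) + ereal (real c) * ereal (real e) \<ge>
    ereal (real f) * ereal (real g) \<longleftrightarrow> f * g \<le> a * b + c * e" for a b c e f g :: nat
    by simp (metis of_nat_add of_nat_le_iff of_nat_mult)
  then show ?thesis
    unfolding ptolemaic_def ptol_def
    by (intro ball_cong refl) (simp only: graph_dist_eq_rel_dist[OF wf] conn)
qed

section \<open>Extending Ptolemaic metrics by a point\<close>

text \<open>The axiom \<open>step\<close> makes \<open>d\<close> the shortest-path distance of the graph whose edges are the pairs at
  distance 1.\<close>

locale ptolemaic_metric =
  fixes V :: "'v set" and d :: "'v \<Rightarrow> 'v \<Rightarrow> nat"
  assumes zero: "x \<in> V \<Longrightarrow> y \<in> V \<Longrightarrow> d x y = 0 \<longleftrightarrow> x = y"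
    and sym: "x \<in> V \<Longrightarrow> y \<in> V \<Longrightarrow> d x y = d y x"
    and triangle: "x \<in> V \<Longrightarrow> y \<in> V \<Longrightarrow> z \<in> V \<Longrightarrow> d x z \<le> d x y + d y z"
    and step: "x \<in> V \<Longrightarrow> y \<in> V \<Longrightarrow> d x y = Suc (Suc n) \<Longrightarrow> \<exists>z\<in>V. d x z = 1 \<and> d z y = Suc n"
    and ptol: "x \<in> V \<Longrightarrow> y \<in> V \<Longrightarrow> z \<in> V \<Longrightarrow> u \<in> V \<Longrightarrow> ptol d x y z u"

definition extend_metric :: "('v \<Rightarrow> 'v \<Rightarrow> nat) \<Rightarrow> 'v \<Rightarrow> ('v \<Rightarrow> nat) \<Rightarrow> 'v \<Rightarrow> 'v \<Rightarrow> nat" where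
  "extend_metric d w f a b =
    (if a = w then if b = w then 0 else f b else if b = w then f a else d a b)"

context ptolemaic_metric
begin

lemma extend:
  assumes w: "w \<notin> V"
    and pos: "\<And>u. u \<in> V \<Longrightarrow> 0 < f u"
    and tri1: "\<And>u v. u \<in> V \<Longrightarrow> v \<in> V \<Longrightarrow> f u \<le> f v + d v u"
    and tri2: "\<And>u v. u \<in> V \<Longrightarrow> v \<in> V \<Longrightarrow> d u v \<le> f u + f v"
    and step1: "\<And>u n. u \<in> V \<Longrightarrow> f u = Suc (Suc n) \<Longrightarrow> \<exists>z\<in>V. f z = 1 \<and> d z u = Suc n"
    and step2: "\<And>u n. u \<in> V \<Longrightarrow> f u = Suc (Suc n) \<Longrightarrow> \<exists>z\<in>V. d u z = 1 \<and> f z = Suc n"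
    and pt: "\<And>y z u. y \<in> V \<Longrightarrow> z \<in> V \<Longrightarrow> u \<in> V \<Longrightarrow> f z * d y u \<le> f y * d z u + f u * d y z"
  shows "ptolemaic_metric (insert w V) (extend_metric d w f)"
proof
  let ?e = "extend_metric d w f"
  have old [simp]: "?e a b = d a b" if "a \<in> V" "b \<in> V" for a b
    using that w by (auto simp: extend_metric_def)
  have new [simp]: "?e w b = f b" "?e b w = f b" if "b \<in> V" for b
    using that w by (auto simp: extend_metric_def)
  have ww [simp]: "?e w w = 0" by (simp add: extend_metric_def)
  show zero': "(?e x y = 0) = (x = y)" if "x \<in> insert w V" "y \<in> insert w V" for x y
    using that pos zero w by (auto simp: extend_metric_def)
  show sym': "?e x y = ?e y x" if "x \<in> insert w V" "y \<in> insert w V" for x y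
    using that sym by (auto simp: extend_metric_def)
  have tri3: "f u \<le> d u v + f v" if "u \<in> V" "v \<in> V" for u v
    using tri1[OF that] sym[OF that] by simp
  show "?e x z \<le> ?e x y + ?e y z"
    if "x \<in> insert w V" "y \<in> insert w V" "z \<in> insert w V" for x y z
    using that by (auto simp: triangle tri1 tri2 tri3)
  show "\<exists>z\<in>insert w V. ?e x z = 1 \<and> ?e z y = Suc n"
    if "x \<in> insert w V" "y \<in> insert w V" "?e x y = Suc (Suc n)" for x y n
  proof -
    have "\<exists>z\<in>V. ?e x z = 1 \<and> ?e z y = Suc n"
    proof (cases "x = w")
      case True
      then have "y \<in> V" "f y = Suc (Suc n)" using that by auto
      then show ?thesis using step1[of y n] True by auto
    next
      case False
      then have "x \<in> V" using that by auto
      show ?thesis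
      proof (cases "y = w")
        case True
        then have "f x = Suc (Suc n)" using that \<open>x \<in> V\<close> by auto
        then show ?thesis using step2[of x n] True \<open>x \<in> V\<close> by auto
      next
        case False
        then have "y \<in> V" using that by auto
        then have "d x y = Suc (Suc n)" using that \<open>x \<in> V\<close> by auto
        then show ?thesis using step[of x y n] \<open>x \<in> V\<close> \<open>y \<in> V\<close> by auto
      qed
    qed
    then show ?thesis by blast
  qed
  have rot: "ptol ?e y z u x"
    if "ptol ?e x y z u" "x \<in> insert w V" "y \<in> insert w V" "z \<in> insert w V" "u \<in> insert w V"
    for x y z u
    using that(1) unfolding ptol_def
    using sym'[OF that(2,3)] sym'[OF that(2,4)] sym'[OF that(2,5)] sym'[OF that(3,4)]
      sym'[OF that(3,5)] sym'[OF that(4,5)]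
    by (simp add: algebra_simps)
  have first: "ptol ?e w y z u" if "y \<in> insert w V" "z \<in> insert w V" "u \<in> insert w V" for y z u
    using that by (auto simp: ptol_def pt)
  show "ptol ?e x y z u"
    if V: "x \<in> insert w V" "y \<in> insert w V" "z \<in> insert w V" "u \<in> insert w V" for x y z u
  proof -
    consider "x = w" | "y = w" | "z = w" | "u = w" | "x \<in> V \<and> y \<in> V \<and> z \<in> V \<and> u \<in> V"
      using V by auto
    then show ?thesis
    proof cases
      case 1
      then show ?thesis using first[OF V(2,3,4)] by simp
    next
      case 2
      then have "ptol ?e y z u x" using first[OF V(3,4,1)] by simp
      then show ?thesis using rot V by blast
    next
      case 3
      then have "ptol ?e z u x y" using first[OF V(4,1,2)] by simp
      then show ?thesis using rot V by blast
    next
      case 4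
      then have "ptol ?e u x y z" using first[OF V(1,2,3)] by simp
      then show ?thesis using rot V by blast
    next
      case 5
      then show ?thesis using ptol[of x y z u] by (simp add: ptol_def)
    qed
  qed
qed

lemma extend_pendant:
  assumes w: "w \<notin> V" and v: "v \<in> V"
  shows "ptolemaic_metric (insert w V) (extend_metric d w (\<lambda>u. Suc (d v u)))"
proof (rule extend[OF w])
  show "Suc (d v u) \<le> Suc (d v x) + d x u" if "u \<in> V" "x \<in> V" for u x
    using triangle[of v x u] v that by simp
  show "d u x \<le> Suc (d v u) + Suc (d v x)" if "u \<in> V" "x \<in> V" for u x
    using triangle[of u v x] sym[of u v] v that by simp
  show "\<exists>z\<in>V. Suc (d v z) = 1 \<and> d z u = Suc n" if "u \<in> V" "Suc (d v u) = Suc (Suc n)" for u n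
    using that v zero[of v v] by (auto intro!: bexI[of _ v])
  show "\<exists>z\<in>V. d u z = 1 \<and> Suc (d v z) = Suc n" if u: "u \<in> V" "Suc (d v u) = Suc (Suc n)" for u n
  proof (cases n)
    case 0
    then show ?thesis using u v zero[of v v] sym[of u v] by (auto intro!: bexI[of _ v])
  next
    case (Suc m)
    then obtain z where "z \<in> V" "d u z = 1" "d z v = Suc m"
      using step[of u v m] u v sym[of u v] by auto
    then show ?thesis using Suc v sym[of z v] by (auto intro!: bexI[of _ z])
  qed
  show "Suc (d v z) * d y u \<le> Suc (d v y) * d z u + Suc (d v u) * d y z"
    if "y \<in> V" "z \<in> V" "u \<in> V" for y z u
    using ptol[of v y z u] triangle[of y z u] v that by (simp add: ptol_def)
qed simp

lemma extend_true_twin: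
  assumes w: "w \<notin> V" and v: "v \<in> V"
  shows "ptolemaic_metric (insert w V) (extend_metric d w ((d v)(v := 1)))"
proof (rule extend[OF w])
  let ?f = "(d v)(v := 1)"
  have pos: "0 < d v u" if "u \<in> V" "u \<noteq> v" for u
    using zero[of v u] v that by auto
  show "0 < ?f u" if "u \<in> V" for u using pos[of u] that by auto
  show "?f u \<le> ?f x + d x u" if "u \<in> V" "x \<in> V" for u x
    using triangle[of v x u] v that pos[of x] by auto
  show "d u x \<le> ?f u + ?f x" if "u \<in> V" "x \<in> V" for u x
    using triangle[of u v x] sym[of u v] v that zero[of v v] by auto
  show "\<exists>z\<in>V. ?f z = 1 \<and> d z u = Suc n" if u: "u \<in> V" "?f u = Suc (Suc n)" for u n
  proof -
    have "d v u = Suc (Suc n)" using that by (auto split: if_splits)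
    then obtain z where "z \<in> V" "d v z = 1" "d z u = Suc n"
      using step v u by blast
    then show ?thesis by (auto intro!: bexI[of _ z])
  qed
  show "\<exists>z\<in>V. d u z = 1 \<and> ?f z = Suc n" if u: "u \<in> V" "?f u = Suc (Suc n)" for u n
  proof -
    have "d u v = Suc (Suc n)" using that sym[of u v] v by (auto split: if_splits)
    then obtain z where "z \<in> V" "d u z = 1" "d z v = Suc n"
      using step v u by blast
    then show ?thesis using zero[of v v] sym[of z v] v by (auto intro!: bexI[of _ z])
  qed
  show "?f z * d y u \<le> ?f y * d z u + ?f u * d y z" if V: "y \<in> V" "z \<in> V" "u \<in> V" for y z u
  proof -
    consider "y = z" | "u = z" | "z \<noteq> y" "z \<noteq> u" by auto
    then show ?thesis
    proof cases
      case 3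
      show ?thesis
      proof (cases "z = v")
        case True
        then have "d y u \<le> d v y + d v u" "0 < d v y" "0 < d v u"
          using triangle[of y v u] sym[of y v] pos v V 3 by auto
        moreover have "d v y + d v u \<le> 2 * (d v y * d v u)"
          using \<open>0 < d v y\<close> \<open>0 < d v u\<close> by (auto dest!: gr0_implies_Suc)
        ultimately show ?thesis using True 3 sym[of y v] v V by (auto simp: mult.commute)
      next
        case False
        then show ?thesis
          using ptol[of v y z u] v V sym[of y v] sym[of z v] zero[of v v]
          by (auto simp: ptol_def mult.commute)
      qed
    qed auto
  qed
qed

lemma extend_simplicial_false_twin:
  assumes w: "w \<notin> V" and v: "v \<in> V"
    and nbr: "\<exists>a\<in>V. d v a = 1"
    and simplicial: "\<And>a b. a \<in> V \<Longrightarrow> b \<in> V \<Longrightarrow> d v a = 1 \<Longrightarrow> d v b = 1 \<Longrightarrow> d a b \<le> 1"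
  shows "ptolemaic_metric (insert w V) (extend_metric d w ((d v)(v := 2)))"
proof (rule extend[OF w])
  let ?f = "(d v)(v := 2)"
  have vv: "d v v = 0" using zero v by auto
  have pos: "0 < d v u" if "u \<in> V" "u \<noteq> v" for u
    using zero[of v u] v that by auto
  show "0 < ?f u" if "u \<in> V" for u using pos[of u] that by auto
  show "?f u \<le> ?f x + d x u" if "u \<in> V" "x \<in> V" for u x
    using triangle[of v x u] sym[of v x] v that pos[of x] by auto
  show "d u x \<le> ?f u + ?f x" if "u \<in> V" "x \<in> V" for u x
    using triangle[of u v x] sym[of u v] v that vv by auto
  show "\<exists>z\<in>V. ?f z = 1 \<and> d z u = Suc n" if u: "u \<in> V" "?f u = Suc (Suc n)" for u n
  proof (cases "u = v")
    case True
    then obtain a where "a \<in> V" "d v a = 1" using nbr by auto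
    then show ?thesis using True that vv sym[of a v] v by (auto intro!: bexI[of _ a])
  next
    case False
    then obtain z where "z \<in> V" "d v z = 1" "d z u = Suc n"
      using step[of v u n] v u by auto
    then show ?thesis using vv by (auto intro!: bexI[of _ z])
  qed
  show "\<exists>z\<in>V. d u z = 1 \<and> ?f z = Suc n" if u: "u \<in> V" "?f u = Suc (Suc n)" for u n
  proof (cases "u = v")
    case True
    then obtain a where "a \<in> V" "d v a = 1" using nbr by auto
    then show ?thesis using True that vv by (auto intro!: bexI[of _ a])
  next
    case False
    then have "d u v = Suc (Suc n)" using that sym[of u v] v by auto
    then obtain z where "z \<in> V" "d u z = 1" "d z v = Suc n"
      using step v u by blast
    then show ?thesis using vv sym[of z v] v by (auto intro!: bexI[of _ z])
  qed
  have near: "d y u \<le> d v u" if yu: "y \<in> V" "u \<in> V" "d v y = 1" "u \<noteq> v" for y u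
  proof (cases "d v u = 1")
    case True
    then show ?thesis using simplicial[of y u] that by simp
  next
    case False
    then obtain n where n: "d v u = Suc (Suc n)"
      using pos[of u] yu by (metis One_nat_def Suc_pred' less_numeral_extra(3) not0_implies_Suc)
    then obtain s where "s \<in> V" "d v s = 1" "d s u = Suc n"
      using step v yu by blast
    then show ?thesis
      using simplicial[of y s] triangle[of y s u] that n by simp
  qed
  have prod: "d y u \<le> d v y * d v u" if V: "y \<in> V" "u \<in> V" "y \<noteq> v" "u \<noteq> v" for y u
  proof -
    consider "d v y = 1" | "d v u = 1" | "2 \<le> d v y" "2 \<le> d v u"
      using pos[of y] pos[of u] V by linarith
    then show ?thesis
    proof cases
      case 1
      then show ?thesis using near[of y u] V by simp
    next
      case 2
      then show ?thesis using near[of u y] V sym[of y u] by simp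
    next
      case 3
      have "d v y + d v u \<le> d v y * d v u"
      proof (cases "d v y \<le> d v u")
        case True
        then show ?thesis using mult_le_mono1[OF 3(1), of "d v u"] by linarith
      next
        case False
        then show ?thesis using mult_le_mono2[OF 3(2), of "d v y"] by linarith
      qed
      then show ?thesis using triangle[of y v u] sym[of y v] v V by simp
    qed
  qed
  show "?f z * d y u \<le> ?f y * d z u + ?f u * d y z" if V: "y \<in> V" "z \<in> V" "u \<in> V" for y z u
  proof -
    consider "y = z" | "u = z" | "z \<noteq> y" "z \<noteq> u" by auto
    then show ?thesis
    proof cases
      case 3
      show ?thesis
      proof (cases "z = v")
        case True
        then show ?thesis using 3 prod[of y u] sym[of y v] v V by (auto simp: mult.commute)
      next
        case False
        then show ?thesis
          using ptol[of v y z u] v V sym[of y v] sym[of z v] vv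
          by (auto simp: ptol_def mult.commute)
      qed
    qed auto
  qed
qed

end

section \<open>Oriented trees\<close>

inductive oriented_tree :: "'v set \<Rightarrow> 'v rel \<Rightarrow> bool" where
  single: "oriented_tree {v} {}"
| child: "oriented_tree V R \<Longrightarrow> v \<in> V \<Longrightarrow> w \<notin> V \<Longrightarrow> oriented_tree (insert w V) (insert (v, w) R)"
| parent: "oriented_tree V R \<Longrightarrow> v \<in> V \<Longrightarrow> w \<notin> V \<Longrightarrow> oriented_tree (insert w V) (insert (w, v) R)"

lemma oriented_tree_subset: "oriented_tree V R \<Longrightarrow> R \<subseteq> V \<times> V"
  by (induction rule: oriented_tree.induct) auto

lemma acyclic_pendant:
  assumes fin: "finite V" and E: "E \<subseteq> V \<times> V" and sym: "sym E" and irr: "\<And>a. (a, a) \<notin> E"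
    and acyc: "\<not> (\<exists>xs. rel_cycle E xs)" and edge: "E \<noteq> {}"
  shows "\<exists>w v. (w, v) \<in> E \<and> (\<forall>u. (w, u) \<in> E \<longrightarrow> u = v)"
proof -
  define P where "P xs \<longleftrightarrow> distinct xs \<and> set xs \<subseteq> V \<and> successively (\<lambda>a b. (a, b) \<in> E) xs" for xs
  have bound: "\<forall>xs. P xs \<longrightarrow> length xs < Suc (card V)"
    unfolding P_def using fin by (metis card_mono distinct_card le_imp_less_Suc)
  obtain a b where "(a, b) \<in> E" using edge by auto
  then have ab: "P [a, b]" unfolding P_def using E irr by auto
  obtain xs where xs: "P xs" "\<And>ys. P ys \<Longrightarrow> length ys \<le> length xs"
    using ex_has_greatest_nat[of P "[a, b]" length "Suc (card V)"] ab bound by blast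
  have "2 \<le> length xs" using xs(2)[OF ab] by simp
  then obtain w v ys where wv: "xs = w # v # ys"
    by (cases xs; cases "tl xs") auto
  then have "(w, v) \<in> E" using xs(1) by (auto simp: P_def)
  moreover have "u = v" if wu: "(w, u) \<in> E" for u
  proof (rule ccontr)
    assume "u \<noteq> v"
    have "u \<noteq> w" using wu irr by auto
    show False
    proof (cases "u \<in> set ys")
      case False
      have "P (u # xs)"
        using xs(1) False \<open>u \<noteq> v\<close> \<open>u \<noteq> w\<close> wu sym E unfolding P_def wv by (auto dest: symD)
      then show False using xs(2)[of "u # xs"] by simp
    next
      case True
      then obtain as bs where ys: "ys = as @ u # bs" by (meson split_list)
      have "P (w # v # as @ [u] @ bs)" using xs(1) by (simp add: wv ys)
      then have "distinct (w # v # as @ [u])"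
        "successively (\<lambda>a b. (a, b) \<in> E) ((w # v # as @ [u]) @ bs)"
        by (auto simp: P_def)
      then have "rel_cycle E (w # v # as @ [u])"
        using wu sym unfolding rel_cycle_def successively_append_iff by (auto dest: symD)
      then show False using acyc by blast
    qed
  qed
  ultimately show ?thesis by blast
qed

lemma rel_cycle_mono:
  assumes "rel_cycle E xs" "E \<subseteq> F" shows "rel_cycle F xs"
proof -
  have "successively (\<lambda>a b. (a, b) \<in> F) xs"
    by (rule successively_mono[of "\<lambda>a b. (a, b) \<in> E"])
      (use assms in \<open>auto simp: rel_cycle_def\<close>)
  then show ?thesis using assms by (auto simp: rel_cycle_def)
qed

lemma rtrancl_remove_pendant:
  assumes "(a, b) \<in> E\<^sup>*" "a \<noteq> w" "b \<noteq> w"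
    and nbr: "\<And>u. (w, u) \<in> E \<Longrightarrow> u = v" "\<And>u. (u, w) \<in> E \<Longrightarrow> u = v"
  shows "(a, b) \<in> (E \<inter> (- {w}) \<times> (- {w}))\<^sup>*"
proof -
  let ?F = "E \<inter> (- {w}) \<times> (- {w})"
  have "if b = w then (a, v) \<in> ?F\<^sup>* else (a, b) \<in> ?F\<^sup>*"
    using assms(1)
  proof (induction rule: rtrancl_induct)
    case base
    then show ?case using assms(2) by simp
  next
    case (step y z)
    show ?case
    proof (cases "y = w \<or> z = w")
      case True
      then show ?thesis using step nbr by (auto split: if_splits)
    next
      case False
      then have "(y, z) \<in> ?F" using step by auto
      then show ?thesis using step False by (auto intro: rtrancl_into_rtrancl)
    qed
  qed
  then show ?thesis using assms(3) by simp
qed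

lemma oriented_treeI:
  assumes "finite V" "V \<noteq> {}" "R \<subseteq> V \<times> V" "acyclic R"
    and "\<And>u v. u \<in> V \<Longrightarrow> v \<in> V \<Longrightarrow> (u, v) \<in> (symcl R)\<^sup>*"
    and "\<not> (\<exists>xs. rel_cycle (symcl R) xs)"
  shows "oriented_tree V R"
  using assms
proof (induction "card V" arbitrary: V R rule: less_induct)
  case less
  have irr: "(a, a) \<notin> symcl R" for a using less.prems(4) by (auto simp: acyclic_def)
  show ?case
  proof (cases "R = {}")
    case True
    have "u = v" if "u \<in> V" "v \<in> V" for u v
      using less.prems(5)[OF that] True by (auto elim: converse_rtranclE)
    then obtain v where "V = {v}" using less.prems(2) by blast
    then show ?thesis using True single by simp
  next
    case False
    have "symcl R \<subseteq> V \<times> V" using less.prems(3) by (auto simp: symcl_def)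
    moreover have "sym (symcl R)" by (auto simp: sym_def)
    moreover have "symcl R \<noteq> {}" using False by (auto simp: symcl_def)
    ultimately obtain w v where wv: "(w, v) \<in> symcl R" and only: "\<And>u. (w, u) \<in> symcl R \<Longrightarrow> u = v"
      using acyclic_pendant[OF less.prems(1) _ _ irr less.prems(6)] by metis
    have V: "w \<in> V" "v \<in> V" "w \<noteq> v" using wv less.prems(3) irr by auto
    define R' where "R' = R \<inter> (- {w}) \<times> (- {w})"
    have sR': "symcl R' = symcl R \<inter> (- {w}) \<times> (- {w})"
      by (auto simp: R'_def symcl_def)
    have "oriented_tree (V - {w}) R'"
    proof (rule less.hyps)
      show "card (V - {w}) < card V" using V less.prems(1) by (meson card_Diff1_less)
      show "acyclic R'" using less.prems(4) by (rule acyclic_subset) (auto simp: R'_def)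
      show "(a, b) \<in> (symcl R')\<^sup>*" if "a \<in> V - {w}" "b \<in> V - {w}" for a b
        unfolding sR'
        by (rule rtrancl_remove_pendant[where v = v]) (use that less.prems(5) only in auto)
      show "\<not> (\<exists>xs. rel_cycle (symcl R') xs)"
        using less.prems(6) rel_cycle_mono[of "symcl R'" _ "symcl R"] sR' by blast
    qed (use less.prems V in \<open>auto simp: R'_def\<close>)
    moreover have "insert w (V - {w}) = V" using V by auto
    moreover have "R = insert (v, w) R' \<or> R = insert (w, v) R'"
    proof -
      have "\<not> ((v, w) \<in> R \<and> (w, v) \<in> R)"
        using less.prems(4) by (meson acyclic_def r_into_trancl trancl_trans)
      moreover have "a \<noteq> w \<and> b \<noteq> w \<or> a = w \<and> b = v \<or> a = v \<and> b = w" if "(a, b) \<in> R" for a b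
        using only[of a] only[of b] that by auto
      ultimately show ?thesis using wv V by (auto simp: R'_def)
    qed
    ultimately show ?thesis
      using child[of "V - {w}" R' v w] parent[of "V - {w}" R' v w] V by auto
  qed
qed

definition share :: "'v rel \<Rightarrow> 'v \<Rightarrow> 'v \<Rightarrow> bool" where
  "share R u v \<longleftrightarrow> (\<exists>w. (w, u) \<in> R\<^sup>* \<and> (w, v) \<in> R\<^sup>*)"

lemma rtrancl_insert_child:
  assumes "R \<subseteq> V \<times> V" "v \<in> V" "w \<notin> V"
  shows "(a, b) \<in> (insert (v, w) R)\<^sup>* \<longleftrightarrow> (a, b) \<in> R\<^sup>* \<or> (b = w \<and> (a, v) \<in> R\<^sup>*)"
proof -
  have "x = w" if "(w, x) \<in> R\<^sup>*" for x
    using that assms by (auto elim: converse_rtranclE)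
  then show ?thesis by (auto simp: rtrancl_insert)
qed

lemma rtrancl_insert_parent:
  assumes "R \<subseteq> V \<times> V" "v \<in> V" "w \<notin> V"
  shows "(a, b) \<in> (insert (w, v) R)\<^sup>* \<longleftrightarrow> (a, b) \<in> R\<^sup>* \<or> (a = w \<and> (v, b) \<in> R\<^sup>*)"
proof -
  have "x = w" if "(x, w) \<in> R\<^sup>*" for x
    using that assms by (auto elim: rtranclE)
  then show ?thesis by (auto simp: rtrancl_insert)
qed

lemma rtrancl_outside:
  assumes "R \<subseteq> V \<times> V" "w \<notin> V"
  shows "(w, b) \<in> R\<^sup>* \<longleftrightarrow> b = w" "(b, w) \<in> R\<^sup>* \<longleftrightarrow> b = w"
  using assms by (auto elim: rtranclE converse_rtranclE)

text \<open>Besides the vertex \<open>v\<close>, here \<open>(v, False)\<close>, the metric space has a point \<open>(v, True)\<close> which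
  behaves as an additional parent of \<open>v\<close> with no other child. Its presence makes every extension of
  the tree by a pendant vertex a combination of the three extensions above: a new child \<open>w\<close> of \<open>v\<close>
  is a true twin of \<open>v\<close>, and a new parent of \<open>v\<close> is a false twin of \<open>(v, True)\<close>.\<close>

definition ancestry_metric :: "'v set \<Rightarrow> 'v rel \<Rightarrow> ('v \<times> bool \<Rightarrow> 'v \<times> bool \<Rightarrow> nat) \<Rightarrow> bool" where
  "ancestry_metric V R d \<longleftrightarrow> ptolemaic_metric (V \<times> UNIV) d \<and>
    (\<forall>u\<in>V. \<forall>v\<in>V. d (u, False) (v, False) = 1 \<longleftrightarrow> u \<noteq> v \<and> share R u v) \<and>
    (\<forall>u\<in>V. \<forall>v\<in>V. d (v, True) (u, False) = 1 \<longleftrightarrow> (v, u) \<in> R\<^sup>*) \<and>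
    (\<forall>u\<in>V. \<forall>v\<in>V. d (v, True) (u, True) \<noteq> 1)"

lemma ancestry_metric_single:
  "\<exists>d. ancestry_metric {v} {} d"
proof
  have "(x, y) = (v, False) \<or> (x, y) = (v, True)" if "x = v" for x y using that by auto
  then show "ancestry_metric {v} {} (\<lambda>a b. if a = b then 0 else 1)"
    by (auto simp: ancestry_metric_def ptolemaic_metric_def ptol_def split: if_splits)
qed

lemma ancestry_metric_child:
  assumes m: "ancestry_metric V R d" and R: "R \<subseteq> V \<times> V" and v: "v \<in> V" and w: "w \<notin> V"
  shows "\<exists>d. ancestry_metric (insert w V) (insert (v, w) R) d"
proof
  interpret ptolemaic_metric "V \<times> UNIV" d using m by (simp add: ancestry_metric_def)
  define d1 where "d1 = extend_metric d (w, False) ((d (v, False))((v, False) := 1))"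
  define d2 where "d2 = extend_metric d1 (w, True) (\<lambda>u. Suc (d1 (w, False) u))"
  have m1: "ptolemaic_metric (insert (w, False) (V \<times> UNIV)) d1"
    unfolding d1_def by (rule extend_true_twin) (use v w in auto)
  have "ptolemaic_metric (insert (w, True) (insert (w, False) (V \<times> UNIV))) d2"
    unfolding d2_def by (rule ptolemaic_metric.extend_pendant[OF m1]) (use w in auto)
  moreover have "insert (w, True) (insert (w, False) (V \<times> UNIV)) = insert w V \<times> UNIV"
    using UNIV_bool by auto
  ultimately have m2: "ptolemaic_metric (insert w V \<times> UNIV) d2" by simp
  let ?R = "insert (v, w) R"
  note rt = rtrancl_insert_child[OF R v w] rtrancl_outside[OF R w]
  have sh: "share ?R a b \<longleftrightarrow> share R a b" "share ?R w a \<longleftrightarrow> share R v a" "share ?R a w \<longleftrightarrow> share R a v"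
    if "a \<in> V" "b \<in> V" for a b
    using that w by (auto simp: share_def rt)
  define f where "f = (d (v, False))((v, False) := 1)"
  have old: "d2 (a, i) (b, j) = d (a, i) (b, j)" if "a \<in> V" "b \<in> V" for a b i j
    using that w by (auto simp: d2_def d1_def extend_metric_def)
  have twin: "d2 (w, False) (b, j) = f (b, j)" "d2 (b, j) (w, False) = f (b, j)" if "b \<in> V" for b j
    using that w by (auto simp: d2_def d1_def extend_metric_def f_def)
  have pend: "d2 (w, True) (b, j) = Suc (f (b, j))" "d2 (b, j) (w, True) = Suc (f (b, j))"
    if "b \<in> V" for b j
    using that w by (auto simp: d2_def d1_def extend_metric_def f_def)
  have ww: "d2 (w, False) (w, False) = 0" "d2 (w, True) (w, False) = 1" "d2 (w, True) (w, True) = 0"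
    using w by (auto simp: d2_def d1_def extend_metric_def)
  have vv: "share R v v" by (auto simp: share_def)
  have FF: "d (a, False) (b, False) = 1 \<longleftrightarrow> a \<noteq> b \<and> share R a b"
    and TF: "d (a, True) (b, False) = 1 \<longleftrightarrow> (a, b) \<in> R\<^sup>*"
    and TT: "d (a, True) (b, True) \<noteq> 1" if "a \<in> V" "b \<in> V" for a b
    using m that by (auto simp: ancestry_metric_def)
  have FT: "d (b, False) (a, True) = 1 \<longleftrightarrow> (a, b) \<in> R\<^sup>*" if "a \<in> V" "b \<in> V" for a b
    using TF[OF that] sym[of "(b, False)" "(a, True)"] that by simp
  have fF: "f (b, False) = Suc 0 \<longleftrightarrow> share R v b" and fT: "f (b, True) = Suc 0 \<longleftrightarrow> (b, v) \<in> R\<^sup>*"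
    and pos: "f (b, j) \<noteq> 0" if "b \<in> V" for b j
    using FF[OF v that] FT[OF that v] vv zero[of "(v, False)" "(b, j)"] that v by (auto simp: f_def)
  have share_sym: "share R a b \<longleftrightarrow> share R b a" for a b by (auto simp: share_def)
  show "ancestry_metric (insert w V) ?R d2"
    unfolding ancestry_metric_def
  proof (intro conjI m2 ballI)
    fix a b assume ab: "a \<in> insert w V" "b \<in> insert w V"
    then consider "a = w" "b = w" | "a = w" "b \<in> V" | "a \<in> V" "b = w" | "a \<in> V" "b \<in> V" by auto
    then have "(d2 (a, False) (b, False) = 1 \<longleftrightarrow> a \<noteq> b \<and> share ?R a b) \<and>
      (d2 (b, True) (a, False) = 1 \<longleftrightarrow> (b, a) \<in> ?R\<^sup>*) \<and> d2 (b, True) (a, True) \<noteq> 1"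
    proof cases
      case 1
      then show ?thesis by (simp add: ww)
    next
      case 2
      then have "b \<noteq> w" using w by auto
      with 2 show ?thesis by (simp add: twin pend fF fT pos sh rt share_sym)
    next
      case 3
      then have "a \<noteq> w" using w by auto
      with 3 show ?thesis by (simp add: twin pend fF fT pos sh rt share_sym[of v])
    next
      case 4
      then have "a \<noteq> w" using w by auto
      with 4 show ?thesis using FF[of a b] TF[of b a] TT[of b a] by (simp add: old sh rt)
    qed
    then show "d2 (a, False) (b, False) = 1 \<longleftrightarrow> a \<noteq> b \<and> share ?R a b"
      "d2 (b, True) (a, False) = 1 \<longleftrightarrow> (b, a) \<in> ?R\<^sup>*" "d2 (b, True) (a, True) \<noteq> 1" by blast+
  qed
qed

lemma ancestry_metric_parent:
  assumes m: "ancestry_metric V R d" and R: "R \<subseteq> V \<times> V" and v: "v \<in> V" and w: "w \<notin> V"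
  shows "\<exists>d. ancestry_metric (insert w V) (insert (w, v) R) d"
proof
  interpret ptolemaic_metric "V \<times> UNIV" d using m by (simp add: ancestry_metric_def)
  have FF: "d (a, False) (b, False) = 1 \<longleftrightarrow> a \<noteq> b \<and> share R a b"
    and TF: "d (a, True) (b, False) = 1 \<longleftrightarrow> (a, b) \<in> R\<^sup>*"
    and TT: "d (a, True) (b, True) \<noteq> 1" if "a \<in> V" "b \<in> V" for a b
    using m that by (auto simp: ancestry_metric_def)
  define d1 where "d1 = extend_metric d (w, False) ((d (v, True))((v, True) := 2))"
  define d2 where "d2 = extend_metric d1 (w, True) ((d1 (w, False))((w, False) := 1))"
  have m1: "ptolemaic_metric (insert (w, False) (V \<times> UNIV)) d1"
    unfolding d1_def
  proof (rule extend_simplicial_false_twin)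
    show "\<exists>a\<in>V \<times> UNIV. d (v, True) a = 1"
      using TF[OF v v] v by auto
    show "d a b \<le> 1" if "a \<in> V \<times> UNIV" "b \<in> V \<times> UNIV" "d (v, True) a = 1" "d (v, True) b = 1" for a b
    proof -
      obtain a' i b' j where [simp]: "a = (a', i)" "b = (b', j)" by (cases a; cases b)
      have [simp]: "\<not> i" "\<not> j" using that TT[OF v] by (cases i; cases j; auto)+
      have "share R a' b'" using that TF[OF v] by (auto simp: share_def)
      then show ?thesis using FF[of a' b'] zero[of a b] that by (cases "a' = b'") auto
    qed
  qed (use v w in auto)
  have "ptolemaic_metric (insert (w, True) (insert (w, False) (V \<times> UNIV))) d2"
    unfolding d2_def by (rule ptolemaic_metric.extend_true_twin[OF m1]) (use w in auto)
  moreover have "insert (w, True) (insert (w, False) (V \<times> UNIV)) = insert w V \<times> UNIV"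
    using UNIV_bool by auto
  ultimately have m2: "ptolemaic_metric (insert w V \<times> UNIV) d2" by simp
  let ?R = "insert (w, v) R"
  note rt = rtrancl_insert_parent[OF R v w] rtrancl_outside[OF R w]
  have sh: "share ?R a b \<longleftrightarrow> share R a b" "share ?R w a \<longleftrightarrow> (v, a) \<in> R\<^sup>*" "share ?R a w \<longleftrightarrow> (v, a) \<in> R\<^sup>*"
    if "a \<in> V" "b \<in> V" for a b
    using that w by (auto simp: share_def rt)
  have old: "d2 (a, i) (b, j) = d (a, i) (b, j)" if "a \<in> V" "b \<in> V" for a b i j
    using that w by (auto simp: d2_def d1_def extend_metric_def)
  define f where "f = (d (v, True))((v, True) := 2)"
  have twin: "d2 (w, i) (b, j) = f (b, j)" "d2 (b, j) (w, i) = f (b, j)" if "b \<in> V" for b i j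
    using that w by (auto simp: d2_def d1_def extend_metric_def f_def)
  have ww: "d2 (w, False) (w, False) = 0" "d2 (w, True) (w, False) = 1" "d2 (w, True) (w, True) = 0"
    using w by (auto simp: d2_def d1_def extend_metric_def)
  have fF: "f (b, False) = Suc 0 \<longleftrightarrow> (v, b) \<in> R\<^sup>*" and fT: "f (b, True) \<noteq> Suc 0" if "b \<in> V" for b
    using TF[OF v that] TT[OF v that] by (auto simp: f_def)
  show "ancestry_metric (insert w V) ?R d2"
    unfolding ancestry_metric_def
  proof (intro conjI m2 ballI)
    fix a b assume ab: "a \<in> insert w V" "b \<in> insert w V"
    then consider "a = w" "b = w" | "a = w" "b \<in> V" | "a \<in> V" "b = w" | "a \<in> V" "b \<in> V" by auto
    then have "(d2 (a, False) (b, False) = 1 \<longleftrightarrow> a \<noteq> b \<and> share ?R a b) \<and>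
      (d2 (b, True) (a, False) = 1 \<longleftrightarrow> (b, a) \<in> ?R\<^sup>*) \<and> d2 (b, True) (a, True) \<noteq> 1"
    proof cases
      case 1
      then show ?thesis by (simp add: ww)
    next
      case 2
      then have "b \<noteq> w" using w by auto
      with 2 show ?thesis by (simp add: twin fF fT sh rt)
    next
      case 3
      then have "a \<noteq> w" using w by auto
      with 3 show ?thesis by (simp add: twin fF fT sh rt)
    next
      case 4
      then have "b \<noteq> w" using w by auto
      with 4 show ?thesis using FF[of a b] TF[of b a] TT[of b a] by (simp add: old sh rt)
    qed
    then show "d2 (a, False) (b, False) = 1 \<longleftrightarrow> a \<noteq> b \<and> share ?R a b"
      "d2 (b, True) (a, False) = 1 \<longleftrightarrow> (b, a) \<in> ?R\<^sup>*" "d2 (b, True) (a, True) \<noteq> 1" by blast+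
  qed
qed

lemma ancestry_metric_ex: "oriented_tree V R \<Longrightarrow> \<exists>d. ancestry_metric V R d"
proof (induction rule: oriented_tree.induct)
  case (single v)
  then show ?case by (rule ancestry_metric_single)
next
  case (child V R v w)
  then show ?case using ancestry_metric_child oriented_tree_subset by metis
next
  case (parent V R v w)
  then show ?case using ancestry_metric_parent oriented_tree_subset by metis
qed

lemma rel_dist_eq_ancestry_metric:
  assumes m: "ancestry_metric V R d" and R: "R \<subseteq> V \<times> V"
    and L: "L \<subseteq> V" and r: "\<And>v. v \<in> V \<Longrightarrow> r v \<in> L \<and> (v, r v) \<in> R\<^sup>*" "\<And>v. v \<in> L \<Longrightarrow> r v = v"
    and E: "E = {(x, y). x \<in> L \<and> y \<in> L \<and> x \<noteq> y \<and> share R x y}"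
    and xy: "x \<in> L" "y \<in> L"
  shows "(x, y) \<in> E\<^sup>*" "rel_dist E x y = d (x, False) (y, False)"
proof -
  interpret ptolemaic_metric "V \<times> UNIV" d using m by (simp add: ancestry_metric_def)
  have share: "share R (fst a) (fst b)" if "a \<in> V \<times> UNIV" "b \<in> V \<times> UNIV" "d a b = 1" for a b
  proof -
    obtain a' i b' j where [simp]: "a = (a', i)" "b = (b', j)" by (cases a; cases b)
    have "d (b', j) (a', i) = 1" using that sym by simp
    then have "share R a' b' \<or> (a', b') \<in> R\<^sup>* \<or> (b', a') \<in> R\<^sup>*"
      using m that by (cases i; cases j) (auto simp: ancestry_metric_def)
    then show ?thesis by (auto simp: share_def)
  qed
  have lower: "d (x, False) (y, False) \<le> n" if "(x, y) \<in> E ^^ n" "x \<in> L" "y \<in> L" for x y n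
    using that
  proof (induction n arbitrary: y)
    case 0
    then show ?case using zero[of "(x, False)" "(x, False)"] L by auto
  next
    case (Suc n)
    then obtain z where z: "(x, z) \<in> E ^^ n" "(z, y) \<in> E" by auto
    then have "z \<in> L" "z \<noteq> y" "share R z y" using E by auto
    have V: "x \<in> V" "z \<in> V" "y \<in> V" using L Suc.prems(2,3) \<open>z \<in> L\<close> by auto
    then have "d (z, False) (y, False) = 1"
      using m \<open>z \<noteq> y\<close> \<open>share R z y\<close> by (simp add: ancestry_metric_def)
    moreover have "d (x, False) (z, False) \<le> n"
      using Suc.IH z(1) Suc.prems(2) \<open>z \<in> L\<close> by blast
    ultimately show ?case
      using triangle[of "(x, False)" "(z, False)" "(y, False)"] V by simp
  qed
  have adj: "r u = r v \<or> (r u, r v) \<in> E" if "share R u v" "u \<in> V" "v \<in> V" for u v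
  proof -
    have "share R (r u) (r v)"
      using that r(1) unfolding share_def by (meson rtrancl_trans)
    then show ?thesis using r(1) that E by auto
  qed
  have upper: "\<exists>k\<le>n. (r (fst a), r (fst b)) \<in> E ^^ k"
    if "a \<in> V \<times> UNIV" "b \<in> V \<times> UNIV" "d a b = n" for a b n
    using that
  proof (induction n arbitrary: a)
    case 0
    then show ?case using zero[of a b] by auto
  next
    case (Suc n)
    note IH = Suc.IH and prems = Suc.prems
    show ?case
    proof (cases n)
      case 0
      then have "share R (fst a) (fst b)" using share prems by auto
      then have "r (fst a) = r (fst b) \<or> (r (fst a), r (fst b)) \<in> E"
        using adj prems by (auto simp: mem_Times_iff)
      then show ?thesis
      proof
        assume "r (fst a) = r (fst b)"
        then show ?thesis by (intro exI[of _ 0]) auto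
      next
        assume "(r (fst a), r (fst b)) \<in> E"
        then show ?thesis by (intro exI[of _ 1]) auto
      qed
    next
      case (Suc m)
      then obtain z where z: "z \<in> V \<times> UNIV" "d a z = 1" "d z b = n"
        using step[of a b m] prems by auto
      then obtain k where k: "k \<le> n" "(r (fst z), r (fst b)) \<in> E ^^ k"
        using IH prems by blast
      have "r (fst a) = r (fst z) \<or> (r (fst a), r (fst z)) \<in> E"
        using adj share[of a z] prems z by (auto simp: mem_Times_iff)
      then show ?thesis
      proof
        assume "r (fst a) = r (fst z)"
        then show ?thesis using k by (intro exI[of _ k]) auto
      next
        assume "(r (fst a), r (fst z)) \<in> E"
        then show ?thesis using k by (intro exI[of _ "Suc k"]) (auto intro: relpow_Suc_I2 simp del: relpow.simps)
      qed
    qed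
  qed
  obtain k where k: "k \<le> d (x, False) (y, False)" "(x, y) \<in> E ^^ k"
    using upper[of "(x, False)" "(y, False)", OF _ _ refl] xy L r(2) by auto
  then show *: "(x, y) \<in> E\<^sup>*" by (auto simp: rtrancl_power)
  show "rel_dist E x y = d (x, False) (y, False)"
    using rel_dist_le[OF k(2)] k(1) lower[OF relpow_rel_dist[OF *]] xy by simp
qed

lemma arboreal_network_oriented_tree:
  assumes "network_on X N" "arboreal N"
  shows "oriented_tree (pverts N) (parcs N)"
proof -
  interpret N: pair_digraph N using assms(1) by (simp add: network_on_def)
  have wf: "pair_wf_digraph N" by unfold_locales
  show ?thesis
  proof (rule oriented_treeI)
    show "parcs N \<subseteq> pverts N \<times> pverts N" using N.in_arcsD1 N.in_arcsD2 by auto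
  qed (use assms N.pair_finite_verts in
      \<open>auto simp: network_on_def arboreal_def undirected_tree_def connected_iff_rtrancl[OF wf]
        undirected_acyclic_iff[OF wf]\<close>)
qed

lemma network_leaf_below:
  assumes "network_on X N" "v \<in> pverts N"
  shows "\<exists>x\<in>X. (v, Inl x) \<in> (parcs N)\<^sup>*"
proof -
  interpret N: pair_digraph N using assms(1) by (simp add: network_on_def)
  have "wf ((parcs N)\<inverse>)"
    using N.pair_finite_arcs assms(1) by (simp add: network_on_def finite_acyclic_wf_converse)
  then show ?thesis using assms(2)
  proof (induction v rule: wf_induct_rule)
    case (less v)
    show ?case
    proof (cases "\<exists>w. (v, w) \<in> parcs N")
      case True
      then obtain w where w: "(v, w) \<in> parcs N" by blast
      then obtain x where "x \<in> X" "(w, Inl x) \<in> (parcs N)\<^sup>*"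
        using less.IH[of w] N.in_arcsD2 by auto
      then show ?thesis using w by (meson converse_rtrancl_into_rtrancl)
    next
      case False
      then have "out_degree (with_proj N) v = 0" by (simp add: out_degree_with_proj)
      moreover from this have "in_degree (with_proj N) v = 1"
        using less.prems assms(1) by (simp add: network_on_def)
      ultimately have "v \<in> leaves N" using less.prems by (simp add: leaves_def)
      then show ?thesis using assms(1) by (auto simp: network_on_def)
    qed
  qed
qed

lemma network_leaf_sink:
  assumes "network_on X N" "x \<in> X" "(Inl x, v) \<in> (parcs N)\<^sup>*"
  shows "v = Inl x"
proof -
  interpret N: pair_digraph N using assms(1) by (simp add: network_on_def)
  have "finite {w. (Inl x, w) \<in> parcs N}"
    by (rule finite_subset[OF _ N.pair_finite_verts]) (use N.in_arcsD2 in auto)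
  moreover have "Inl x \<in> leaves N" using assms(1,2) by (auto simp: network_on_def)
  ultimately have "{w. (Inl x, w) \<in> parcs N} = {}"
    by (simp add: leaves_def out_degree_with_proj)
  then show ?thesis using assms(3) by (auto elim: converse_rtranclE)
qed

lemma share_ancestor_iff_share:
  assumes "pair_wf_digraph N" "u \<in> pverts N"
  shows "share_ancestor N u v \<longleftrightarrow> share (parcs N) u v"
proof -
  have "w \<in> pverts N" if "(w, u) \<in> (parcs N)\<^sup>*" for w
    using that assms by (auto elim: converse_rtranclE dest: pair_wf_digraph.in_arcsD1)
  then show ?thesis
    by (auto simp: share_ancestor_def share_def reachable_iff_rtrancl[OF assms(1)])
qed

theorem ptolemaic_of_arboreal_network:
  fixes N :: "('a + 'b) pair_pre_digraph"
  assumes G: "pair_graph G" "Digraph_Component.connected (with_proj G)" "pverts G = X"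
    and N: "network_on X N" "arboreal N" "represents X N G"
  shows "ptolemaic G"
proof -
  interpret N: pair_digraph N using N(1) by (simp add: network_on_def)
  have wf: "pair_wf_digraph N" by unfold_locales
  have leaf: "Inl x \<in> pverts N" if "x \<in> X" for x
  proof -
    have "Inl x \<in> leaves N" using that N(1) by (auto simp: network_on_def)
    then show ?thesis by (simp add: leaves_def)
  qed
  have tree: "oriented_tree (pverts N) (parcs N)" by (rule arboreal_network_oriented_tree[OF N(1,2)])
  then obtain d where d: "ancestry_metric (pverts N) (parcs N) d" using ancestry_metric_ex by blast
  have R: "parcs N \<subseteq> pverts N \<times> pverts N" by (rule oriented_tree_subset[OF tree])
  have "\<forall>v\<in>pverts N. \<exists>l. l \<in> Inl ` X \<and> (v, l) \<in> (parcs N)\<^sup>*"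
    using network_leaf_below[OF N(1)] by blast
  then obtain r where r: "\<And>v. v \<in> pverts N \<Longrightarrow> r v \<in> Inl ` X \<and> (v, r v) \<in> (parcs N)\<^sup>*" by metis
  have r': "r v = v" if "v \<in> Inl ` X" for v
    using that r[of v] network_leaf_sink[OF N(1)] leaf by auto
  define E where "E = {(x, y). x \<in> Inl ` X \<and> y \<in> Inl ` X \<and> x \<noteq> y \<and> share (parcs N) x y}"
  have arcs: "parcs G = {(x, y). x \<in> X \<and> y \<in> X \<and> x \<noteq> y \<and> share (parcs N) (Inl x) (Inl y)}"
    using N(3) share_ancestor_iff_share[OF wf leaf]
    by (auto simp: represents_def shared_ancestry_graph_def)
  have E_iff: "(Inl x, l) \<in> E ^^ n \<longleftrightarrow> (\<exists>y. l = Inl y \<and> (x, y) \<in> parcs G ^^ n)" for x l n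
  proof (induction n arbitrary: l)
    case (Suc n)
    then show ?case by (fastforce simp: E_def arcs relcomp_unfold)
  qed auto
  have dist: "rel_dist (parcs G) x y = d (Inl x, False) (Inl y, False)" if "x \<in> X" "y \<in> X" for x y
  proof -
    have "rel_dist E (Inl x) (Inl y) = d (Inl x, False) (Inl y, False)"
      by (rule rel_dist_eq_ancestry_metric(2)[OF d R _ r r' E_def]) (use that leaf in auto)
    then show ?thesis by (simp add: rel_dist_def E_iff)
  qed
  interpret ptolemaic_metric "pverts N \<times> UNIV" d using d by (simp add: ancestry_metric_def)
  show ?thesis
    unfolding ptolemaic_iff_rel_dist[OF G(1,2)] G(3)
  proof (intro ballI)
    fix x y z u assume X: "x \<in> X" "y \<in> X" "z \<in> X" "u \<in> X"
    then show "ptol (rel_dist (parcs G)) x y z u"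
      using ptol[of "(Inl x, False)" "(Inl y, False)" "(Inl z, False)" "(Inl u, False)"] leaf
      by (simp add: ptol_def dist)
  qed
qed

section \<open>Maximal cliques of a connected graph\<close>

locale connected_pair_graph = pair_graph G for G :: "'a pair_pre_digraph" +
  assumes connected: "Digraph_Component.connected (with_proj G)"
    and card_verts: "2 \<le> card (pverts G)"
begin

abbreviation "K \<equiv> max_cliques G"
abbreviation "C \<equiv> intersections K"
abbreviation "d \<equiv> rel_dist (parcs G)"

lemma arc_sym: "(u, v) \<in> parcs G \<Longrightarrow> (v, u) \<in> parcs G"
  using sym_arcs by (auto simp: symmetric_def sym_def)

lemma symcl_parcs: "symcl (parcs G) = parcs G"
  using arc_sym by auto

lemma rtrancl_parcs: "u \<in> pverts G \<Longrightarrow> v \<in> pverts G \<Longrightarrow> (u, v) \<in> (parcs G)\<^sup>*"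
  using connected connected_iff_rtrancl[of G] symcl_parcs by auto

lemma max_clique_subset: "M \<in> K \<Longrightarrow> M \<subseteq> pverts G"
  by (auto simp: max_cliques_def is_clique_def)

lemma max_clique_adjacent: "M \<in> K \<Longrightarrow> a \<in> M \<Longrightarrow> b \<in> M \<Longrightarrow> a \<noteq> b \<Longrightarrow> (a, b) \<in> parcs G"
  by (auto simp: max_cliques_def is_clique_def pairwise_def)

lemma max_clique_card: "M \<in> K \<Longrightarrow> 2 \<le> card M"
  by (auto simp: max_cliques_def is_clique_def)

lemma max_clique_antichain: "M \<in> K \<Longrightarrow> Q \<in> K \<Longrightarrow> M \<subseteq> Q \<Longrightarrow> M = Q"
  by (auto simp: max_cliques_def)

lemma finite_max_cliques: "finite K"
  by (rule finite_subset[of _ "Pow (pverts G)"]) (use max_clique_subset pair_finite_verts in auto)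

lemma clique_in_max_clique:
  assumes "is_clique G Y"
  shows "\<exists>M\<in>K. Y \<subseteq> M"
proof -
  have "finite {Z. is_clique G Z}"
    by (rule finite_subset[of _ "Pow (pverts G)"]) (use pair_finite_verts in \<open>auto simp: is_clique_def\<close>)
  then obtain M where "Y \<subseteq> M" "is_clique G M" "\<And>Z. is_clique G Z \<Longrightarrow> M \<subseteq> Z \<Longrightarrow> M = Z"
    using finite_has_maximal2[of "{Z. is_clique G Z}" Y] assms by auto
  then show ?thesis by (auto simp: max_cliques_def)
qed

lemma arc_in_max_clique:
  assumes "(u, v) \<in> parcs G"
  shows "\<exists>M\<in>K. u \<in> M \<and> v \<in> M"
proof -
  have "u \<noteq> v" using assms no_loops' by blast
  then have "is_clique G {u, v}"
    using assms arc_sym in_arcsD1 in_arcsD2 by (auto simp: is_clique_def pairwise_def)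
  from clique_in_max_clique[OF this] obtain M where "M \<in> K" "{u, v} \<subseteq> M" ..
  then show ?thesis by auto
qed

lemma vertex_in_max_clique:
  assumes "x \<in> pverts G"
  shows "\<exists>M\<in>K. x \<in> M"
proof -
  have "pverts G \<noteq> {x}" using card_verts by auto
  then obtain y where "y \<in> pverts G" "y \<noteq> x" using assms by blast
  moreover from this have "(x, y) \<in> (parcs G)\<^sup>*" using rtrancl_parcs assms by blast
  ultimately obtain z where "(x, z) \<in> parcs G" by (auto elim: converse_rtranclE)
  then show ?thesis using arc_in_max_clique by blast
qed

lemma max_clique_nonadjacent:
  assumes M: "M \<in> K" and q: "q \<in> pverts G" "q \<notin> M"
  shows "\<exists>p\<in>M. (p, q) \<notin> parcs G"
proof (rule ccontr)
  assume "\<not> ?thesis"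
  then have adj: "(p, q) \<in> parcs G" "(q, p) \<in> parcs G" if "p \<in> M" for p using that arc_sym by auto
  have "finite M" using max_clique_subset[OF M] pair_finite_verts finite_subset by blast
  then have "is_clique G (insert q M)"
    using M q adj max_clique_adjacent[OF M] max_clique_card[OF M] max_clique_subset[OF M]
    by (auto simp: is_clique_def pairwise_def card_insert_if)
  then have "insert q M = M" using M by (auto simp: max_cliques_def)
  then show False using q by auto
qed

lemma intersection_subset_max_clique: "A \<in> C \<Longrightarrow> \<exists>M\<in>K. A \<subseteq> M"
  by (auto simp: intersections_def)

lemma intersection_avoid: "A \<in> C \<Longrightarrow> b \<notin> A \<Longrightarrow> \<exists>M\<in>K. A \<subseteq> M \<and> b \<notin> M"
  by (auto simp: intersections_def)

lemma intersection_nonempty: "A \<in> C \<Longrightarrow> A \<noteq> {}"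
  by (auto simp: intersections_def)

lemma max_clique_in_intersections: "M \<in> K \<Longrightarrow> M \<in> C"
  using max_clique_card[of M] by (auto simp: intersections_def intro!: exI[of _ "{M}"])

lemma intersections_Int:
  assumes "A \<in> C" "B \<in> C" "A \<inter> B \<noteq> {}"
  shows "A \<inter> B \<in> C"
proof -
  obtain S T where "A = \<Inter>S" "S \<noteq> {}" "S \<subseteq> K" "B = \<Inter>T" "T \<subseteq> K"
    using assms(1,2) by (auto simp: intersections_def)
  then have "A \<inter> B = \<Inter>(S \<union> T)" "S \<union> T \<noteq> {}" "S \<union> T \<subseteq> K" by auto
  then show ?thesis using assms(3) unfolding intersections_def by blast
qed

lemma intersection_subset_verts: "A \<in> C \<Longrightarrow> A \<subseteq> pverts G"
  using intersection_subset_max_clique max_clique_subset by blast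

lemma finite_intersection: "A \<in> C \<Longrightarrow> finite A"
  using intersection_subset_verts pair_finite_verts finite_subset by blast

lemma finite_intersections: "finite C"
  by (rule finite_subset[of _ "Pow (pverts G)"]) (use intersection_subset_verts pair_finite_verts in auto)

lemma dist_arc_le: "(u, v) \<in> parcs G \<Longrightarrow> d u v \<le> 1"
  by (rule rel_dist_le) simp

lemma dist_self: "d u u = 0"
  using rel_dist_le[of u u 0 "parcs G"] by simp

lemma dist_clique_le: "M \<in> K \<Longrightarrow> a \<in> M \<Longrightarrow> b \<in> M \<Longrightarrow> d a b \<le> 1"
  by (cases "a = b") (simp_all add: dist_self dist_arc_le[simplified] max_clique_adjacent)

lemma dist_ge_2:
  assumes "u \<in> pverts G" "v \<in> pverts G" "u \<noteq> v" "(u, v) \<notin> parcs G"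
  shows "2 \<le> d u v"
proof (rule ccontr)
  assume "\<not> ?thesis"
  then have "d u v = 0 \<or> d u v = 1" by auto
  then show False using relpow_rel_dist[OF rtrancl_parcs[OF assms(1,2)]] assms(3,4) by auto
qed

lemma dist_via_le_2:
  assumes "M \<in> K" "Q \<in> K" "a \<in> M" "c \<in> M" "c \<in> Q" "b \<in> Q"
  shows "d a b \<le> 2"
proof -
  have "\<exists>n\<le>2. (a, b) \<in> parcs G ^^ n"
  proof -
    consider "a = b" | "a \<noteq> b" "a = c" | "a \<noteq> b" "b = c" | "a \<noteq> c" "b \<noteq> c" by auto
    then show ?thesis
    proof cases
      case 1
      then show ?thesis by (intro exI[of _ 0]) auto
    next
      case 2
      then show ?thesis using assms max_clique_adjacent by (intro exI[of _ 1]) auto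
    next
      case 3
      then show ?thesis using assms max_clique_adjacent by (intro exI[of _ 1]) auto
    next
      case 4
      then have "(a, c) \<in> parcs G" "(c, b) \<in> parcs G" using assms max_clique_adjacent by auto
      then have "(a, b) \<in> parcs G ^^ 2" by (auto simp: numeral_2_eq_2)
      then show ?thesis by blast
    qed
  qed
  then obtain n where "n \<le> 2" "(a, b) \<in> parcs G ^^ n" by blast
  then show ?thesis using rel_dist_le[of a b n "parcs G"] by simp
qed

end

section \<open>Cliques of Ptolemaic graphs\<close>

locale ptolemaic_pair_graph = connected_pair_graph +
  assumes ptolemaic: "ptolemaic G"
begin

lemma ptol:
  "x \<in> pverts G \<Longrightarrow> y \<in> pverts G \<Longrightarrow> z \<in> pverts G \<Longrightarrow> u \<in> pverts G \<Longrightarrow>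
    d x z * d y u \<le> d x y * d z u + d x u * d y z"
  using ptolemaic connected pair_graph_axioms ptolemaic_iff_rel_dist[of G] by (auto simp: ptol_def)

lemma no_gem:
  assumes V: "x \<in> pverts G" "y \<in> pverts G" "z \<in> pverts G" "u \<in> pverts G"
    and "d x y \<le> 1" "d z u \<le> 1" "d y z \<le> 1" "d x u \<le> 2"
    and "2 \<le> d x z" "2 \<le> d y u"
  shows False
proof -
  have "2 * 2 \<le> d x z * d y u" by (rule mult_le_mono) fact+
  also have "\<dots> \<le> d x y * d z u + d x u * d y z" using ptol[OF V] .
  also have "\<dots> \<le> 1 * 1 + 2 * 1" by (intro add_le_mono mult_le_mono) fact+
  finally show False by simp
qed

lemma differences_nonadjacent:
  assumes Y: "Y \<in> K" and Z: "Z \<in> K" and c: "c \<in> Y" "c \<in> Z"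
    and a: "a \<in> Y" "a \<notin> Z" and b: "b \<in> Z" "b \<notin> Y"
  shows "(a, b) \<notin> parcs G"
proof
  assume ab: "(a, b) \<in> parcs G"
  have V: "a \<in> pverts G" "b \<in> pverts G" using a b Y Z max_clique_subset by auto
  obtain y where y: "y \<in> Y" "(y, b) \<notin> parcs G" using max_clique_nonadjacent[OF Y V(2) b(2)] by blast
  obtain z where z: "z \<in> Z" "(z, a) \<notin> parcs G" using max_clique_nonadjacent[OF Z V(1) a(2)] by blast
  have V': "y \<in> pverts G" "z \<in> pverts G" using y z Y Z max_clique_subset by auto
  show False
  proof (rule no_gem[of y a b z])
    show "2 \<le> d y b" by (rule dist_ge_2) (use y b V V' in auto)
    show "2 \<le> d a z" by (rule dist_ge_2) (use z a V V' arc_sym in auto)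
  qed (use V V' y z a b c Y Z ab dist_clique_le dist_arc_le dist_via_le_2 in blast)+
qed

lemma laminar:
  assumes M: "M \<in> K" "A \<subseteq> M" "B \<subseteq> M" and AB: "A \<in> C" "B \<in> C" "A \<inter> B \<noteq> {}"
  shows "A \<subseteq> B \<or> B \<subseteq> A"
proof (rule ccontr)
  assume "\<not> ?thesis"
  then obtain a b c where abc: "a \<in> A" "a \<notin> B" "b \<in> B" "b \<notin> A" "c \<in> A" "c \<in> B" using AB(3) by blast
  obtain Y where Y: "Y \<in> K" "A \<subseteq> Y" "b \<notin> Y" using intersection_avoid AB(1) abc(4) by blast
  obtain Z where Z: "Z \<in> K" "B \<subseteq> Z" "a \<notin> Z" using intersection_avoid AB(2) abc(2) by blast
  have "(a, b) \<in> parcs G" using max_clique_adjacent[OF M(1)] M abc by blast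
  moreover have "(a, b) \<notin> parcs G"
    by (rule differences_nonadjacent[OF Y(1) Z(1), of c]) (use Y Z abc in auto)
  ultimately show False by blast
qed

lemma induced_path_geodesic:
  assumes V: "\<And>i. i \<le> k \<Longrightarrow> y i \<in> pverts G"
    and path: "\<And>i. i < k \<Longrightarrow> (y i, y (Suc i)) \<in> parcs G"
    and distinct: "\<And>i j. i < j \<Longrightarrow> j \<le> k \<Longrightarrow> y i \<noteq> y j"
    and induced: "\<And>i j. i < j \<Longrightarrow> j \<le> k \<Longrightarrow> (y i, y j) \<in> parcs G \<Longrightarrow> j = Suc i"
  shows "i + n \<le> k \<Longrightarrow> d (y i) (y (i + n)) = n"
proof (induction n arbitrary: i rule: less_induct)
  case (less n)
  have "(y i, y (i + n)) \<in> parcs G ^^ n"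
    unfolding relpow_fun_conv by (intro exI[of _ "\<lambda>j. y (i + j)"]) (use path less.prems in auto)
  then have upper: "d (y i) (y (i + n)) \<le> n" by (rule rel_dist_le)
  consider "n = 0" | "n = 1" | "n = 2" | m where "n = Suc (Suc m)" "0 < m"
    by (metis One_nat_def Suc_1 gr0I not0_implies_Suc)
  then show ?case
  proof cases
    case 1
    then show ?thesis using upper by simp
  next
    case 2
    then have "y i \<noteq> y (i + n)" using distinct[of i "i + n"] less.prems by simp
    then have "d (y i) (y (i + n)) \<noteq> 0"
      using relpow_rel_dist[OF rtrancl_parcs[of "y i" "y (i + n)"]] V less.prems by (auto intro!: Nat.gr0I)
    then show ?thesis using upper 2 by simp
  next
    case 3
    have "2 \<le> d (y i) (y (i + n))"
    proof (rule dist_ge_2)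
      show "y i \<in> pverts G" "y (i + n) \<in> pverts G" using V less.prems by simp_all
      show "y i \<noteq> y (i + n)" using distinct[of i "i + n"] less.prems 3 by simp
      show "(y i, y (i + n)) \<notin> parcs G"
      proof
        assume "(y i, y (i + n)) \<in> parcs G"
        have "i < i + n" using 3 by simp
        then have "i + n = Suc i" by (rule induced) fact+
        then show False using 3 by simp
      qed
    qed
    then show ?thesis using upper 3 by simp
  next
    case 4
    let ?D = "d (y i) (y (i + n))"
    have "d (y i) (y (i + Suc m)) = Suc m" using less.IH[of "Suc m" i] 4 less.prems by simp
    moreover have "d (y (Suc i)) (y (i + n)) = Suc m"
      using less.IH[of "Suc m" "Suc i"] 4 less.prems by simp
    moreover have "d (y i) (y (Suc i)) = 1" using less.IH[of 1 i] 4 less.prems by simp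
    moreover have "d (y (i + Suc m)) (y (i + n)) = 1"
      using less.IH[of 1 "i + Suc m"] 4 less.prems by simp
    moreover have "d (y (Suc i)) (y (i + Suc m)) = m" using less.IH[of m "Suc i"] 4 less.prems by simp
    ultimately have "Suc m * Suc m \<le> 1 * 1 + ?D * m"
      using ptol[of "y i" "y (Suc i)" "y (i + Suc m)" "y (i + n)"] V 4 less.prems by simp
    then have "m * (m + 2) \<le> m * ?D" by (simp add: algebra_simps)
    then have "m + 2 \<le> ?D" using 4(2) by (rule mult_left_le_imp_le)
    then show ?thesis using upper 4 by simp
  qed
qed

text \<open>A shortest path from \<open>M - Q\<close> to \<open>Q - M\<close> that avoids \<open>M \<inter> Q\<close> is induced, hence geodesic, and so
  has length at most 2; the remaining two lengths are excluded by the Ptolemaic inequality.\<close>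

lemma max_clique_separator:
  assumes M: "M \<in> K" and Q: "Q \<in> K" and ne: "M \<inter> Q \<noteq> {}"
    and p0: "p0 \<in> M - Q" and q0: "q0 \<in> Q - M"
  shows "(p0, q0) \<notin> (parcs G \<inter> (- (M \<inter> Q)) \<times> (- (M \<inter> Q)))\<^sup>*"
proof
  let ?F = "parcs G \<inter> (- (M \<inter> Q)) \<times> (- (M \<inter> Q))"
  assume "(p0, q0) \<in> ?F\<^sup>*"
  then have ex: "\<exists>k. \<exists>p\<in>M - Q. \<exists>q\<in>Q - M. (p, q) \<in> ?F ^^ k"
    using p0 q0 by (auto simp: rtrancl_power)
  define k where "k = (LEAST k. \<exists>p\<in>M - Q. \<exists>q\<in>Q - M. (p, q) \<in> ?F ^^ k)"
  obtain p q where pq: "p \<in> M - Q" "q \<in> Q - M" "(p, q) \<in> ?F ^^ k"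
    using LeastI_ex[OF ex] unfolding k_def by blast
  have minimal: "k \<le> j" if "p' \<in> M - Q" "q' \<in> Q - M" "(p', q') \<in> ?F ^^ j" for p' q' j
    unfolding k_def by (rule Least_le) (use that in blast)
  obtain c where c: "c \<in> M" "c \<in> Q" using ne by blast
  have V: "p \<in> pverts G" "q \<in> pverts G" "c \<in> pverts G" using pq c M Q max_clique_subset by auto
  obtain y where y: "y 0 = p" "y k = q" "\<And>i. i < k \<Longrightarrow> (y i, y (Suc i)) \<in> ?F"
    using pq(3) unfolding relpow_fun_conv by blast
  have seg: "(y i, y j) \<in> ?F ^^ (j - i)" if "i \<le> j" "j \<le> k" for i j
    unfolding relpow_fun_conv by (intro exI[of _ "\<lambda>l. y (i + l)"]) (use y(3) that in auto)
  have k0: "k \<noteq> 0"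
  proof
    assume "k = 0"
    then have "p = q" using y(1,2) by simp
    then show False using pq(1,2) by auto
  qed
  have out: "y i \<in> pverts G \<and> y i \<notin> M \<inter> Q" if "i \<le> k" for i
  proof (cases "i = k")
    case True
    then show ?thesis using y pq V by auto
  next
    case False
    then show ?thesis using y(3)[of i] that in_arcsD1 by auto
  qed
  have short: "k \<le> i + l + (k - j)" if "i \<le> j" "j \<le> k" "(y i, y j) \<in> ?F ^^ l" for i j l
  proof -
    have "(p, y i) \<in> ?F ^^ i" "(y j, q) \<in> ?F ^^ (k - j)"
      using seg[of 0 i] seg[of j k] y that by auto
    then have "(p, q) \<in> ?F ^^ (i + l + (k - j))"
      using that(3) unfolding relpow_add by blast
    then show ?thesis using minimal pq by blast
  qed
  have distinct: "y i \<noteq> y j" if "i < j" "j \<le> k" for i j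
    using short[of i j 0] that by auto
  have induced: "j = Suc i" if "i < j" "j \<le> k" "(y i, y j) \<in> parcs G" for i j
  proof -
    have "(y i, y j) \<in> ?F ^^ 1" using that out[of i] out[of j] by auto
    then show ?thesis using short[of i j 1] that by linarith
  qed
  have "d (y 0) (y (0 + k)) = k"
    by (rule induced_path_geodesic[of k y]) (use out y(3) distinct induced in auto)
  moreover have "d p q \<le> 2" by (rule dist_via_le_2[OF M Q]) (use pq c in auto)
  ultimately have "k \<le> 2" using y by simp
  then consider "k = 1" | "k = 2" using k0 by linarith
  then show False
  proof cases
    case 1
    then have "(p, q) \<in> parcs G" using y(1,2) y(3)[of 0] by simp
    then show False using differences_nonadjacent[OF M Q c] pq by blast
  next
    case 2
    define z where "z = y 1"
    have pz: "(p, z) \<in> ?F" "(z, q) \<in> ?F"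
      using y(1,2) y(3)[of 0] y(3)[of 1] 2 by (simp_all add: z_def numeral_2_eq_2)
    have zV: "z \<in> pverts G" using pz in_arcsD1 by blast
    have "z \<notin> M"
    proof
      assume "z \<in> M"
      then have "k \<le> 1" using minimal[of z q 1] pz pq by auto
      then show False using 2 by simp
    qed
    have pq2: "2 \<le> d p q"
      by (rule dist_ge_2) (use V pq differences_nonadjacent[OF M Q c] in auto)
    have zq: "d z q \<le> 1" "d p z \<le> 1" using pz dist_arc_le by auto
    have adj: "(b, z) \<in> parcs G" if "b \<in> M \<inter> Q" for b
    proof (rule ccontr)
      assume "(b, z) \<notin> parcs G"
      have "2 \<le> d b z"
        by (rule dist_ge_2) (use that \<open>(b, z) \<notin> parcs G\<close> \<open>z \<notin> M\<close> zV max_clique_subset[OF M] in auto)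
      moreover have "d b p \<le> 1" "d b q \<le> 2"
        using dist_clique_le[OF M] dist_via_le_2[OF M Q, of b b q] that pq by auto
      ultimately show False
        using no_gem[of b p z q] pq2 zq that zV V max_clique_subset[OF M] by auto
    qed
    obtain p' where p': "p' \<in> M" "(p', z) \<notin> parcs G"
      using max_clique_nonadjacent[OF M zV \<open>z \<notin> M\<close>] by blast
    then have p'V: "p' \<in> pverts G" using max_clique_subset[OF M] by auto
    show False
    proof (rule no_gem[of p' p z q])
      show "2 \<le> d p' z" by (rule dist_ge_2) (use p' p'V zV \<open>z \<notin> M\<close> in auto)
      show "d p' p \<le> 1" using dist_clique_le[OF M] p' pq by auto
      show "d p' q \<le> 2" using dist_via_le_2[OF M Q p'(1) c] pq by auto
    qed (use V zV p'V zq pq2 in auto)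
  qed
qed

end

lemma rel_cycle_rotate:
  assumes "rel_cycle E (xs @ ys)"
  shows "rel_cycle E (ys @ xs)"
proof (cases "xs = [] \<or> ys = []")
  case False
  then show ?thesis
    using assms unfolding rel_cycle_def successively_append_iff by auto
qed (use assms in auto)

context ptolemaic_pair_graph
begin

lemma nested_chain_connects:
  assumes "successively (\<lambda>A A'. (A, A') \<in> symcl (parcs (cover_digraph C))) Zs" "Zs \<noteq> []"
    and "\<And>Z. Z \<in> set Zs \<Longrightarrow> Z \<in> C \<and> \<not> Z \<subseteq> B"
    and "p \<in> hd Zs - B" "q \<in> last Zs - B"
  shows "(p, q) \<in> (parcs G \<inter> (- B) \<times> (- B))\<^sup>*"
  using assms
proof (induction Zs arbitrary: p)
  case (Cons A Zs)
  let ?F = "parcs G \<inter> (- B) \<times> (- B)"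
  have inA: "(a, b) \<in> ?F\<^sup>*" if ab: "a \<in> A - B" "b \<in> A - B" for a b
  proof -
    obtain M where "M \<in> K" "A \<subseteq> M" using intersection_subset_max_clique Cons.prems(3)[of A] by auto
    then have "a = b \<or> (a, b) \<in> parcs G" using max_clique_adjacent ab by blast
    then show ?thesis using ab by auto
  qed
  show ?case
  proof (cases "Zs = []")
    case True
    then show ?thesis using inA Cons.prems by simp
  next
    case False
    then have hd: "(A, hd Zs) \<in> symcl (parcs (cover_digraph C))"
      and succ: "successively (\<lambda>A A'. (A, A') \<in> symcl (parcs (cover_digraph C))) Zs"
      using Cons.prems(1) by (auto simp: successively_Cons)
    have hd_not: "\<not> hd Zs \<subseteq> B" using Cons.prems(3)[of "hd Zs"] False by auto
    have A_not: "\<not> A \<subseteq> B" using Cons.prems(3)[of A] by auto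
    from hd have "A \<subseteq> hd Zs \<or> hd Zs \<subseteq> A" by (auto simp: cover_digraph_def)
    then obtain s where s: "s \<in> A - B" "s \<in> hd Zs - B" using hd_not A_not by blast
    have "(s, q) \<in> ?F\<^sup>*"
      by (rule Cons.IH[OF succ False _ s(2)]) (use Cons.prems(3,5) False in auto)
    moreover have "(p, s) \<in> ?F\<^sup>*" using inA Cons.prems(4) s by simp
    ultimately show ?thesis by (rule rtrancl_trans[rotated])
  qed
qed simp

text \<open>A smallest set \<open>B\<close> on a cycle of the cover digraph has two parents \<open>A\<close> and \<open>A'\<close> on the cycle.
  No other set of the cycle is contained in \<open>B\<close>, so the rest of the cycle joins \<open>A - B\<close> to \<open>A' - B\<close>
  in the graph without \<open>B\<close>. But \<open>B\<close> is the intersection of any maximal cliques containing \<open>A\<close> and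
  \<open>A'\<close>, and separates them.\<close>

lemma cover_digraph_acyclic: "\<not> (\<exists>xs. rel_cycle (symcl (parcs (cover_digraph C))) xs)"
proof
  let ?H = "symcl (parcs (cover_digraph C))"
  assume "\<exists>xs. rel_cycle ?H xs"
  then obtain xs where xs: "rel_cycle ?H xs" by blast
  then have "xs \<noteq> []" by (auto simp: rel_cycle_def)
  then have "hd xs \<in> set xs" by simp
  from ex_has_least_nat[of "\<lambda>Z. Z \<in> set xs", OF this, of card]
  obtain B where B: "B \<in> set xs" "\<And>Z. Z \<in> set xs \<Longrightarrow> card B \<le> card Z" by blast
  obtain us vs where "xs = us @ B # vs" using B(1) by (meson split_list)
  then have "rel_cycle ?H ((B # vs) @ us)" using xs rel_cycle_rotate by metis
  moreover define Zs where "Zs = vs @ us"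
  ultimately have cyc: "rel_cycle ?H (B # Zs)" by simp
  have setZ: "set (B # Zs) = set xs" using \<open>xs = us @ B # vs\<close> by (auto simp: Zs_def)
  have len: "2 \<le> length Zs" and dist: "B \<notin> set Zs" "distinct Zs"
    and succ: "successively (\<lambda>A A'. (A, A') \<in> ?H) Zs"
    using cyc by (auto simp: rel_cycle_def successively_Cons)
  have ne: "Zs \<noteq> []" using len by auto
  define A A' where "A = hd Zs" and "A' = last Zs"
  have H: "(B, A) \<in> ?H" "(A', B) \<in> ?H"
    using cyc ne by (auto simp: rel_cycle_def successively_Cons A_def A'_def)
  have in_C: "Z \<in> C" if "Z \<in> set (B # Zs)" for Z
  proof -
    have field: "Z \<in> C" if "(Z, W) \<in> ?H" for Z W using that by (auto simp: cover_digraph_def)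
    have "\<exists>W. (Z, W) \<in> ?H"
    proof -
      obtain es fs where split: "B # Zs = es @ Z # fs" using \<open>Z \<in> set (B # Zs)\<close> by (meson split_list)
      then have "rel_cycle ?H ((Z # fs) @ es)" using cyc rel_cycle_rotate by metis
      then have "successively (\<lambda>A A'. (A, A') \<in> ?H) (Z # (fs @ es))" "fs @ es \<noteq> []"
        using len split by (auto simp: rel_cycle_def)
      then show ?thesis by (auto simp: successively_Cons)
    qed
    then show ?thesis using field by blast
  qed
  have not_sub: "\<not> Z \<subseteq> B" if "Z \<in> set Zs" for Z
  proof
    assume "Z \<subseteq> B"
    moreover have "card B \<le> card Z" using B(2) setZ that by auto
    ultimately have "Z = B" using finite_intersection[OF in_C[of B]] by (simp add: card_seteq)
    then show False using that dist by auto
  qed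
  have AZ: "A \<in> set Zs" "A' \<in> set Zs" using ne by (auto simp: A_def A'_def)
  then have arcs: "(A, B) \<in> parcs (cover_digraph C)" "(A', B) \<in> parcs (cover_digraph C)"
    using H not_sub by (auto simp: cover_digraph_def)
  have "A \<noteq> A'"
    using dist(2) len by (cases Zs; cases "tl Zs") (auto simp: A_def A'_def split: if_splits)
  have BA: "B \<subset> A" "B \<subset> A'" and cover: "\<And>D. D \<in> C \<Longrightarrow> B \<subset> D \<Longrightarrow> \<not> D \<subset> A"
      "\<And>D. D \<in> C \<Longrightarrow> B \<subset> D \<Longrightarrow> \<not> D \<subset> A'"
    using arcs by (auto simp: cover_digraph_def)
  have C: "A \<in> C" "A' \<in> C" "B \<in> C" using in_C AZ by auto
  have Bne: "B \<noteq> {}" using intersection_nonempty C by blast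
  obtain M where M: "M \<in> K" "A \<subseteq> M" using intersection_subset_max_clique C by blast
  obtain Q where Q: "Q \<in> K" "A' \<subseteq> Q" using intersection_subset_max_clique C by blast
  have "\<not> A \<subseteq> Q"
  proof
    assume "A \<subseteq> Q"
    then have "A \<subseteq> A' \<or> A' \<subseteq> A" by (rule laminar[OF Q(1)]) (use Q C BA Bne in auto)
    then show False using cover C BA \<open>A \<noteq> A'\<close> by blast
  qed
  have AQne: "A \<inter> Q \<noteq> {}" using Q BA Bne by blast
  then have MQne: "M \<inter> Q \<noteq> {}" using M by blast
  have MQ_C: "M \<inter> Q \<in> C"
    by (rule intersections_Int) (use M Q max_clique_in_intersections MQne in auto)
  have "A \<inter> Q \<in> C" by (rule intersections_Int) (use C Q max_clique_in_intersections AQne in auto)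
  then have AQ: "A \<inter> Q = B" using cover(1)[of "A \<inter> Q"] \<open>\<not> A \<subseteq> Q\<close> BA Q by blast
  have "M \<inter> Q \<subseteq> A \<or> A \<subseteq> M \<inter> Q" by (rule laminar[OF M(1)]) (use M C MQ_C AQne in auto)
  then have "M \<inter> Q \<subseteq> A" using \<open>\<not> A \<subseteq> Q\<close> by blast
  then have MQ: "M \<inter> Q = B" using AQ M Q BA by blast
  obtain p q where pq: "p \<in> A - B" "q \<in> A' - B" using BA by blast
  have "(p, q) \<in> (parcs G \<inter> (- B) \<times> (- B))\<^sup>*"
    by (rule nested_chain_connects[OF succ ne]) (use in_C not_sub pq in \<open>auto simp: A_def A'_def\<close>)
  moreover have "(p, q) \<notin> (parcs G \<inter> (- (M \<inter> Q)) \<times> (- (M \<inter> Q)))\<^sup>*"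
    by (rule max_clique_separator[OF M(1) Q(1) MQne]) (use M Q MQ pq in auto)
  ultimately show False by (simp add: MQ)
qed

lemma private_edge:
  assumes M: "M \<in> K"
  shows "\<exists>x\<in>M. \<exists>y\<in>M. x \<noteq> y \<and> (\<forall>Z\<in>K. x \<in> Z \<longrightarrow> y \<in> Z \<longrightarrow> Z = M)"
proof (cases "\<exists>Q\<in>K. Q \<noteq> M \<and> M \<inter> Q \<noteq> {}")
  case True
  let ?S = "{Q \<in> K. Q \<noteq> M \<and> M \<inter> Q \<noteq> {}}"
  have "finite ?S" "?S \<noteq> {}" using finite_max_cliques True by auto
  then have fin: "finite ((\<lambda>Z. card (M \<inter> Z)) ` ?S)" "(\<lambda>Z. card (M \<inter> Z)) ` ?S \<noteq> {}" by auto
  obtain Q where Q1: "Q \<in> ?S" "Max ((\<lambda>Z. card (M \<inter> Z)) ` ?S) = card (M \<inter> Q)"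
    using Max_in[OF fin] by (rule imageE)
  have Q: "card (M \<inter> Z) \<le> card (M \<inter> Q)" if "Z \<in> ?S" for Z
    using Max_ge[OF fin(1) imageI[OF that]] unfolding Q1(2) .
  obtain x where x: "x \<in> M" "x \<in> Q" using Q1(1) by blast
  obtain y where y: "y \<in> M" "y \<notin> Q" using Q1(1) max_clique_antichain[OF M] by blast
  have "Z = M" if Z: "Z \<in> K" "x \<in> Z" "y \<in> Z" for Z
  proof (rule ccontr)
    assume "Z \<noteq> M"
    then have "card (M \<inter> Z) \<le> card (M \<inter> Q)" using Q Z x by blast
    have "M \<inter> Q \<subseteq> M \<inter> Z \<or> M \<inter> Z \<subseteq> M \<inter> Q"
      by (rule laminar[OF M]) (use M Q1(1) Z x max_clique_in_intersections in \<open>auto intro!: intersections_Int\<close>)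
    then have "M \<inter> Q \<subset> M \<inter> Z" using y Z by blast
    then have "card (M \<inter> Q) < card (M \<inter> Z)"
      using finite_intersection[OF max_clique_in_intersections[OF M]] by (simp add: psubset_card_mono)
    then show False using \<open>card (M \<inter> Z) \<le> card (M \<inter> Q)\<close> by simp
  qed
  then have "\<forall>Z\<in>K. x \<in> Z \<longrightarrow> y \<in> Z \<longrightarrow> Z = M" by blast
  moreover have "x \<noteq> y" using x y by blast
  ultimately show ?thesis using x(1) y(1) by blast
next
  case False
  obtain T where "T \<subseteq> M" "card T = 2"
    using obtain_subset_with_card_n[OF max_clique_card[OF M]] by blast
  then obtain x y where "x \<in> M" "y \<in> M" "x \<noteq> y" by (auto simp: card_2_iff)
  moreover have "\<forall>Z\<in>K. x \<in> Z \<longrightarrow> y \<in> Z \<longrightarrow> Z = M" using False \<open>x \<in> M\<close> by blast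
  ultimately show ?thesis by blast
qed

theorem ecc_eq_card_max_cliques: "ecc G = card K"
  unfolding ecc_def
proof (rule Least_equality)
  have "\<forall>Y\<in>K. is_clique G Y" by (simp add: max_cliques_def)
  then have "edge_clique_cover G K"
    unfolding edge_clique_cover_def using arc_in_max_clique by blast
  then show "\<exists>K'. edge_clique_cover G K' \<and> finite K' \<and> card K' = card K"
    using finite_max_cliques by blast
next
  fix n assume "\<exists>K'. edge_clique_cover G K' \<and> finite K' \<and> card K' = n"
  then obtain K' where K': "edge_clique_cover G K'" "finite K'" "card K' = n" by blast
  have "\<exists>Y\<in>K'. \<forall>Z\<in>K. Y \<subseteq> Z \<longrightarrow> Z = M" if M: "M \<in> K" for M
  proof -
    obtain x y where xy: "x \<in> M" "y \<in> M" "x \<noteq> y" "\<forall>Z\<in>K. x \<in> Z \<longrightarrow> y \<in> Z \<longrightarrow> Z = M"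
      using private_edge[OF M] by blast
    then have "(x, y) \<in> parcs G" using max_clique_adjacent M by blast
    then obtain Y where "Y \<in> K'" "x \<in> Y" "y \<in> Y" using K'(1) by (auto simp: edge_clique_cover_def)
    then show ?thesis using xy(4) by (intro bexI[of _ Y]) auto
  qed
  then have "\<forall>M\<in>K. \<exists>Y. Y \<in> K' \<and> (\<forall>Z\<in>K. Y \<subseteq> Z \<longrightarrow> Z = M)" by blast
  from bchoice[OF this] obtain f
    where *: "\<forall>M\<in>K. f M \<in> K' \<and> (\<forall>Z\<in>K. f M \<subseteq> Z \<longrightarrow> Z = M)" ..
  have f: "f M \<in> K'" "\<And>Z. Z \<in> K \<Longrightarrow> f M \<subseteq> Z \<Longrightarrow> Z = M" if "M \<in> K" for M
    using bspec[OF * that] by simp_all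
  have "inj_on f K"
  proof (rule inj_onI)
    fix M Q assume MQ: "M \<in> K" "Q \<in> K" "f M = f Q"
    have "is_clique G (f M)" using f(1)[OF MQ(1)] K'(1) by (auto simp: edge_clique_cover_def)
    from clique_in_max_clique[OF this] obtain Z where "Z \<in> K" "f M \<subseteq> Z" ..
    then show "M = Q" using f(2)[of M Z] f(2)[of Q Z] MQ by simp
  qed
  then show "card K \<le> n"
    using card_inj_on_le[of f K K'] f(1) K'(2,3) by (simp add: image_subset_iff)
qed

end

section \<open>Renaming vertices\<close>

definition rename :: "('v \<Rightarrow> 'w) \<Rightarrow> 'v pair_pre_digraph \<Rightarrow> 'w pair_pre_digraph" where
  "rename f D = \<lparr>pverts = f ` pverts D, parcs = map_prod f f ` parcs D\<rparr>"

lemma rename_sel [simp]: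
  "pverts (rename f D) = f ` pverts D" "parcs (rename f D) = map_prod f f ` parcs D"
  by (simp_all add: rename_def)

lemma trancl_map_prod_image:
  assumes "inj_on f V" "R \<subseteq> V \<times> V" "(a, b) \<in> (map_prod f f ` R)\<^sup>+"
  shows "\<exists>u v. a = f u \<and> b = f v \<and> (u, v) \<in> R\<^sup>+"
  using assms(3)
proof (induction rule: trancl_induct)
  case (base b)
  then show ?case by auto
next
  case (step b c)
  then obtain u v where uv: "a = f u" "b = f v" "(u, v) \<in> R\<^sup>+" by blast
  from step(2) obtain s t where st: "b = f s" "c = f t" "(s, t) \<in> R" by auto
  have "v \<in> V" "s \<in> V" using trancl_subset_Sigma[OF assms(2)] uv(3) st(3) assms(2) by auto
  then have "v = s" using inj_onD[OF assms(1)] uv(2) st(1) by simp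
  then have "(u, t) \<in> R\<^sup>+" using uv(3) st(3) by simp
  then show ?case using uv(1) st(2) by blast
qed

lemma acyclic_map_prod_image:
  assumes "inj_on f V" "R \<subseteq> V \<times> V" "acyclic R"
  shows "acyclic (map_prod f f ` R)"
proof (rule acyclicI, intro allI notI)
  fix x assume "(x, x) \<in> (map_prod f f ` R)\<^sup>+"
  from trancl_map_prod_image[OF assms(1,2) this]
  obtain u v where uv: "x = f u" "x = f v" "(u, v) \<in> R\<^sup>+" by blast
  have "u \<in> V" "v \<in> V" using trancl_subset_Sigma[OF assms(2)] uv(3) by auto
  then have "u = v" using inj_onD[OF assms(1)] uv(1,2) by simp
  then show False using uv(3) assms(3) by (simp add: acyclic_def)
qed

lemma rtrancl_map_prod_imageI: "(u, v) \<in> R\<^sup>* \<Longrightarrow> (f u, f v) \<in> (map_prod f f ` R)\<^sup>*"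
proof (induction rule: rtrancl_induct)
  case (step y z)
  then have "(f y, f z) \<in> map_prod f f ` R" by force
  then show ?case using step.IH by (rule rtrancl_into_rtrancl[rotated])
qed simp

lemma rtrancl_map_prod_image_iff:
  assumes "inj_on f V" "R \<subseteq> V \<times> V" "u \<in> V" "v \<in> V"
  shows "(f u, f v) \<in> (map_prod f f ` R)\<^sup>* \<longleftrightarrow> (u, v) \<in> R\<^sup>*"
proof
  assume "(f u, f v) \<in> (map_prod f f ` R)\<^sup>*"
  then consider "f u = f v" | "(f u, f v) \<in> (map_prod f f ` R)\<^sup>+" by (auto simp: rtrancl_eq_or_trancl)
  then show "(u, v) \<in> R\<^sup>*"
  proof cases
    case 1
    then have "u = v" using inj_onD[OF assms(1)] assms(3,4) by simp
    then show ?thesis by simp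
  next
    case 2
    from trancl_map_prod_image[OF assms(1,2) this]
    obtain s t where st: "f u = f s" "f v = f t" "(s, t) \<in> R\<^sup>+" by blast
    have "s \<in> V" "t \<in> V" using trancl_subset_Sigma[OF assms(2)] st(3) by auto
    then have "u = s" "v = t" using inj_onD[OF assms(1)] st(1,2) assms(3,4) by simp_all
    then show ?thesis using st(3) by simp
  qed
qed (rule rtrancl_map_prod_imageI)

lemma symcl_map_prod_image: "symcl (map_prod f f ` R) = map_prod f f ` symcl R"
  by (simp add: symcl_def image_Un image_image case_prod_beta' map_prod_def)

lemma rel_cycle_map:
  assumes "rel_cycle E xs" "inj_on f (set xs)"
    and "\<And>a b. a \<in> set xs \<Longrightarrow> b \<in> set xs \<Longrightarrow> (a, b) \<in> E \<Longrightarrow> (f a, f b) \<in> F"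
  shows "rel_cycle F (map f xs)"
proof -
  have ne: "xs \<noteq> []" using assms(1) by (auto simp: rel_cycle_def)
  have "successively (\<lambda>a b. (f a, f b) \<in> F) xs"
    by (rule successively_mono[of "\<lambda>a b. (a, b) \<in> E"])
      (use assms(1,3) in \<open>simp_all add: rel_cycle_def\<close>)
  moreover have "(f (last xs), f (hd xs)) \<in> F"
    by (rule assms(3)) (use assms(1) ne in \<open>simp_all add: rel_cycle_def\<close>)
  ultimately show ?thesis
    using assms(1,2) ne by (simp add: rel_cycle_def distinct_map successively_map last_map hd_map)
qed

lemma rel_cycle_two_neighbours:
  assumes "rel_cycle E xs" "x \<in> set xs"
  shows "\<exists>a b. a \<noteq> b \<and> (a, x) \<in> E \<and> (x, b) \<in> E"
proof -
  obtain us vs where "xs = us @ x # vs" using assms(2) by (meson split_list)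
  then have "rel_cycle E (us @ (x # vs))" using assms(1) by simp
  then have cyc: "rel_cycle E (x # (vs @ us))" using rel_cycle_rotate[of E us "x # vs"] by simp
  define zs where "zs = vs @ us"
  have len: "2 \<le> length zs" using cyc unfolding zs_def[symmetric] by (simp add: rel_cycle_def)
  moreover from len have "zs \<noteq> []" by auto
  then have "distinct zs" "(x, hd zs) \<in> E" "(last zs, x) \<in> E"
    using cyc unfolding zs_def[symmetric] by (simp_all add: rel_cycle_def successively_Cons)
  moreover from this have "hd zs \<noteq> last zs"
    using len by (cases zs; cases "tl zs") (auto split: if_splits)
  ultimately show ?thesis by metis
qed

lemma rel_cycle_in_rename:
  assumes "inj_on f V" "R \<subseteq> V \<times> V" "rel_cycle (map_prod f f ` R) xs"
  shows "\<exists>ys. rel_cycle R ys"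
proof -
  let ?g = "inv_into V f"
  have img: "map_prod f f ` R \<subseteq> f ` V \<times> f ` V" using assms(2) by auto
  have "set xs \<subseteq> f ` V"
  proof
    fix x assume "x \<in> set xs"
    from rel_cycle_two_neighbours[OF assms(3) this] obtain b where "(x, b) \<in> map_prod f f ` R" by (elim exE conjE)
    then show "x \<in> f ` V" using img by blast
  qed
  have "rel_cycle R (map ?g xs)"
  proof (rule rel_cycle_map[OF assms(3)])
    show "inj_on ?g (set xs)" using inj_on_inv_into[OF \<open>set xs \<subseteq> f ` V\<close>] .
    fix a b assume "(a, b) \<in> map_prod f f ` R"
    then obtain u v where uv: "(u, v) \<in> R" "a = f u" "b = f v" by auto
    then have "u \<in> V" "v \<in> V" using assms(2) by auto
    then show "(?g a, ?g b) \<in> R" using uv inv_into_f_f[OF assms(1)] by simp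
  qed
  then show ?thesis ..
qed

lemma in_degree_rename:
  assumes "inj_on f (pverts D)" "pair_wf_digraph D" "v \<in> pverts D"
  shows "in_degree (with_proj (rename f D)) (f v) = in_degree (with_proj D) v"
proof -
  have R: "parcs D \<subseteq> pverts D \<times> pverts D" using assms(2) by (auto dest: pair_wf_digraph.wellformed')
  have "{u. (u, f v) \<in> map_prod f f ` parcs D} = f ` {u. (u, v) \<in> parcs D}"
  proof (intro equalityI subsetI)
    fix a assume "a \<in> {u. (u, f v) \<in> map_prod f f ` parcs D}"
    then obtain u w where uw: "(u, w) \<in> parcs D" "a = f u" "f v = f w" by auto
    then have "w = v" using inj_onD[OF assms(1)] assms(3) R by auto
    then show "a \<in> f ` {u. (u, v) \<in> parcs D}" using uw by auto
  qed force
  moreover have "inj_on f {u. (u, v) \<in> parcs D}" using R by (auto intro: inj_on_subset[OF assms(1)])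
  ultimately show ?thesis by (simp add: in_degree_with_proj card_image)
qed

lemma out_degree_rename:
  assumes "inj_on f (pverts D)" "pair_wf_digraph D" "v \<in> pverts D"
  shows "out_degree (with_proj (rename f D)) (f v) = out_degree (with_proj D) v"
proof -
  have R: "parcs D \<subseteq> pverts D \<times> pverts D" using assms(2) by (auto dest: pair_wf_digraph.wellformed')
  have "{w. (f v, w) \<in> map_prod f f ` parcs D} = f ` {w. (v, w) \<in> parcs D}"
  proof (intro equalityI subsetI)
    fix a assume "a \<in> {w. (f v, w) \<in> map_prod f f ` parcs D}"
    then obtain u w where uw: "(u, w) \<in> parcs D" "a = f w" "f v = f u" by auto
    then have "u = v" using inj_onD[OF assms(1)] assms(3) R by auto
    then show "a \<in> f ` {w. (v, w) \<in> parcs D}" using uw by auto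
  qed force
  moreover have "inj_on f {w. (v, w) \<in> parcs D}" using R by (auto intro: inj_on_subset[OF assms(1)])
  ultimately show ?thesis by (simp add: out_degree_with_proj card_image)
qed

lemma pair_digraph_rename:
  assumes "inj_on f (pverts D)" "pair_digraph D"
  shows "pair_digraph (rename f D)"
proof -
  interpret D: pair_digraph D by fact
  show ?thesis
  proof
    show "fst e \<noteq> snd e" if e: "e \<in> parcs (rename f D)" for e
    proof -
      obtain u v where uv: "(u, v) \<in> parcs D" "e = (f u, f v)" using e by auto
      then have "u \<noteq> v" "u \<in> pverts D" "v \<in> pverts D"
        using D.no_loops' D.in_arcsD1 D.in_arcsD2 by blast+
      then show ?thesis using uv inj_onD[OF assms(1), of u v] by auto
    qed
  qed (use D.pair_finite_verts D.pair_finite_arcs D.in_arcsD1 D.in_arcsD2 in auto)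
qed

section \<open>Cover digraphs\<close>

lemma cover_arc_iff:
  "(A, B) \<in> parcs (cover_digraph W) \<longleftrightarrow>
    A \<in> W \<and> B \<in> W \<and> B \<subset> A \<and> (\<forall>D\<in>W. B \<subset> D \<longrightarrow> \<not> D \<subset> A)"
  by (auto simp: cover_digraph_def)

lemma cover_arc_above:
  assumes "finite W" "A \<in> W" "B \<in> W" "B \<subset> A"
  shows "\<exists>D. (A, D) \<in> parcs (cover_digraph W) \<and> B \<subseteq> D"
proof -
  let ?S = "{D \<in> W. B \<subseteq> D \<and> D \<subset> A}"
  have "finite ?S" "B \<in> ?S" using assms by auto
  from finite_has_maximal2[OF this] obtain D
    where D: "D \<in> ?S" "\<forall>D'\<in>?S. D \<subseteq> D' \<longrightarrow> D = D'" by blast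
  have "\<not> D' \<subset> A" if "D' \<in> W" "D \<subset> D'" for D' using D that by blast
  then have "(A, D) \<in> parcs (cover_digraph W)" using D(1) assms(2) by (simp add: cover_arc_iff)
  then show ?thesis using D(1) by blast
qed

lemma cover_arc_below:
  assumes "finite W" "A \<in> W" "B \<in> W" "B \<subset> A"
  shows "\<exists>D. (D, B) \<in> parcs (cover_digraph W) \<and> D \<subseteq> A"
proof -
  let ?S = "{D \<in> W. B \<subset> D \<and> D \<subseteq> A}"
  have "finite ?S" "A \<in> ?S" using assms by auto
  from finite_has_minimal2[OF this] obtain D
    where D: "D \<in> ?S" "\<forall>D'\<in>?S. D' \<subseteq> D \<longrightarrow> D = D'" by blast
  have "\<not> D' \<subset> D" if "D' \<in> W" "B \<subset> D'" for D' using D that by blast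
  then have "(D, B) \<in> parcs (cover_digraph W)" using D(1) assms(3) by (simp add: cover_arc_iff)
  then show ?thesis using D(1) by blast
qed

lemma cover_rtrancl_iff:
  assumes "finite W" "\<And>A. A \<in> W \<Longrightarrow> finite A" "A \<in> W" "B \<in> W"
  shows "(A, B) \<in> (parcs (cover_digraph W))\<^sup>* \<longleftrightarrow> B \<subseteq> A"
proof
  assume "(A, B) \<in> (parcs (cover_digraph W))\<^sup>*"
  then show "B \<subseteq> A" by induction (auto simp: cover_arc_iff)
next
  have "finite A" using assms(2,3) .
  then show "B \<subseteq> A \<Longrightarrow> (A, B) \<in> (parcs (cover_digraph W))\<^sup>*" using assms(3)
  proof (induction A rule: finite_psubset_induct)
    case (psubset A)
    show ?case
    proof (cases "A = B")
      case False
      then have "B \<subset> A" using psubset.prems by auto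
      from cover_arc_above[OF assms(1) psubset.prems(2) assms(4) this]
      obtain D where D: "(A, D) \<in> parcs (cover_digraph W)" "B \<subseteq> D" by blast
      then have "D \<subset> A" "D \<in> W" by (auto simp: cover_arc_iff)
      then have "(D, B) \<in> (parcs (cover_digraph W))\<^sup>*" using psubset.IH D(2) by simp
      then show ?thesis using D(1) by (rule converse_rtrancl_into_rtrancl[rotated])
    qed simp
  qed
qed

lemma add_singletons_eq_cover_digraph:
  assumes "finite C" "{} \<notin> C"
  shows "add_singletons X C = cover_digraph (C \<union> {{x} | x. x \<in> X})"
proof -
  let ?W = "C \<union> {{x} | x. x \<in> X}"
  have arcs: "parcs (add_singletons X C) = parcs (cover_digraph ?W)"
  proof (intro equalityI subrelI)
    fix A B assume "(A, B) \<in> parcs (add_singletons X C)"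
    then consider "(A, B) \<in> parcs (cover_digraph C)"
      | x where "B = {x}" "A \<in> C" "x \<in> X" "{x} \<notin> C" "x \<in> A"
        "\<And>D. (A, D) \<in> parcs (cover_digraph C) \<Longrightarrow> x \<notin> D"
      unfolding add_singletons_def by auto
    then show "(A, B) \<in> parcs (cover_digraph ?W)"
    proof cases
      case 1
      then have AB: "A \<in> C" "B \<in> C" "B \<subset> A" "\<And>D. D \<in> C \<Longrightarrow> B \<subset> D \<Longrightarrow> \<not> D \<subset> A"
        by (auto simp: cover_arc_iff)
      have "B \<noteq> {}" using AB(2) assms(2) by auto
      then have "\<not> B \<subset> {x}" for x by blast
      then show ?thesis using AB by (auto simp: cover_arc_iff)
    next
      case 2
      have "\<not> D \<subset> A" if D: "D \<in> ?W" "{x} \<subset> D" for D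
      proof
        assume "D \<subset> A"
        have "D \<in> C" using D by auto
        from cover_arc_above[OF assms(1) 2(2) this \<open>D \<subset> A\<close>]
        obtain D' where "(A, D') \<in> parcs (cover_digraph C)" "D \<subseteq> D'" by blast
        then show False using 2(6) D(2) by blast
      qed
      moreover have "{x} \<subset> A" using 2 by auto
      ultimately show ?thesis using 2 by (auto simp: cover_arc_iff)
    qed
  next
    fix A B assume AB: "(A, B) \<in> parcs (cover_digraph ?W)"
    have "B \<noteq> {}" using AB assms(2) by (auto simp: cover_arc_iff)
    then have "A \<in> C" using AB by (auto simp: cover_arc_iff)
    show "(A, B) \<in> parcs (add_singletons X C)"
    proof (cases "B \<in> C")
      case True
      then have "(A, B) \<in> parcs (cover_digraph C)" using AB \<open>A \<in> C\<close> by (auto simp: cover_arc_iff)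
      then show ?thesis by (simp add: add_singletons_def)
    next
      case False
      then obtain x where x: "B = {x}" "x \<in> X" using AB by (auto simp: cover_arc_iff)
      have "x \<notin> D" if D: "(A, D) \<in> parcs (cover_digraph C)" for D
      proof
        assume "x \<in> D"
        moreover have "D \<in> C" "D \<subset> A" using D by (auto simp: cover_arc_iff)
        moreover have "D \<noteq> {x}" using False \<open>D \<in> C\<close> x by auto
        ultimately show False using AB x by (auto simp: cover_arc_iff)
      qed
      then show ?thesis using AB x False \<open>A \<in> C\<close> by (auto simp: add_singletons_def cover_arc_iff)
    qed
  qed
  have verts: "pverts (add_singletons X C) = pverts (cover_digraph ?W)"
    by (auto simp: add_singletons_def cover_digraph_def)
  show ?thesis by (rule pair_pre_digraph.equality) (simp_all add: arcs verts)
qed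

section \<open>The network of the maximal cliques\<close>

context connected_pair_graph
begin

definition W :: "'a set set" where
  "W = C \<union> {{x} | x. x \<in> pverts G}"

abbreviation "children A \<equiv> {B. (A, B) \<in> parcs (cover_digraph W)}"
abbreviation "parents A \<equiv> {B. (B, A) \<in> parcs (cover_digraph W)}"

definition split_leaves :: "'a set set" where
  "split_leaves = {{x} | x. x \<in> pverts G \<and> 2 \<le> card (parents {x})}"

definition net :: "('a set + 'a set) pair_pre_digraph" where
  "net = add_children (add_singletons (pverts G) C)"

definition leaf :: "'a \<Rightarrow> 'a set + 'a set" where
  "leaf x = (if {x} \<in> split_leaves then Inr {x} else Inl {x})"

lemma W_cases:
  assumes "A \<in> W"
  obtains "A \<in> C" | x where "x \<in> pverts G" "A = {x}"
  using assms by (auto simp: W_def)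

lemma intersection_in_W: "A \<in> C \<Longrightarrow> A \<in> W"
  by (simp add: W_def)

lemma max_clique_in_W: "M \<in> K \<Longrightarrow> M \<in> W"
  by (rule intersection_in_W[OF max_clique_in_intersections])

lemma singleton_in_W: "x \<in> pverts G \<Longrightarrow> {x} \<in> W"
  by (simp add: W_def)

lemma finite_W: "finite W"
  using finite_intersections pair_finite_verts by (simp add: W_def)

lemma W_finite: "A \<in> W \<Longrightarrow> finite A"
  by (erule W_cases) (simp_all add: finite_intersection)

lemma W_nonempty: "A \<in> W \<Longrightarrow> A \<noteq> {}"
  by (erule W_cases) (simp_all add: intersection_nonempty)

lemma W_subset: "A \<in> W \<Longrightarrow> A \<subseteq> pverts G"
  by (erule W_cases) (simp_all add: intersection_subset_verts)

lemma W_two_elements_in_C: "A \<in> W \<Longrightarrow> x \<in> A \<Longrightarrow> y \<in> A \<Longrightarrow> x \<noteq> y \<Longrightarrow> A \<in> C"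
  by (erule W_cases) simp_all

lemma finite_children: "finite (children A)"
  by (rule finite_subset[OF _ finite_W]) (auto simp: cover_arc_iff)

lemma finite_parents: "finite (parents A)"
  by (rule finite_subset[OF _ finite_W]) (auto simp: cover_arc_iff)

lemma W_singleton_or_card: "A \<in> W \<Longrightarrow> (\<exists>x\<in>pverts G. A = {x}) \<or> 2 \<le> card A"
proof -
  assume A: "A \<in> W"
  obtain x where "x \<in> A" using W_nonempty[OF A] by blast
  show ?thesis
  proof (cases "A = {x}")
    case True
    then show ?thesis using W_subset[OF A] by auto
  next
    case False
    then obtain y where "y \<in> A" "y \<noteq> x" using \<open>x \<in> A\<close> by blast
    then have "card {x, y} \<le> card A" using \<open>x \<in> A\<close> W_finite[OF A] by (intro card_mono) auto
    then show ?thesis using \<open>y \<noteq> x\<close> by simp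
  qed
qed

lemma children_singleton: "children {x} = {}"
proof -
  have "B \<noteq> {}" if "B \<in> W" for B using W_nonempty[OF that] .
  then have "\<not> B \<subset> {x}" if "B \<in> W" for B using that by blast
  then show ?thesis by (auto simp: cover_arc_iff)
qed

lemma child_containing:
  assumes A: "A \<in> W" "2 \<le> card A" and x: "x \<in> A"
  shows "\<exists>B\<in>children A. x \<in> B"
proof -
  have xW: "{x} \<in> W" using W_subset[OF A(1)] x by (intro singleton_in_W) auto
  have "{x} \<subset> A" using A(2) x by auto
  from cover_arc_above[OF finite_W A(1) xW this]
  obtain D where "(A, D) \<in> parcs (cover_digraph W)" "{x} \<subseteq> D" by blast
  then show ?thesis by auto
qed

lemma two_children:
  assumes A: "A \<in> W" "2 \<le> card A"
  shows "2 \<le> card (children A)"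
proof -
  obtain x where "x \<in> A" using W_nonempty[OF A(1)] by blast
  then obtain B where B: "B \<in> children A" using child_containing[OF A] by blast
  then have "B \<subset> A" by (simp add: cover_arc_iff)
  then obtain y where "y \<in> A" "y \<notin> B" by blast
  then obtain B' where B': "B' \<in> children A" "y \<in> B'" using child_containing[OF A] by blast
  then have "B \<noteq> B'" using \<open>y \<notin> B\<close> by blast
  have "card {B, B'} \<le> card (children A)" by (rule card_mono[OF finite_children]) (use B B' in simp)
  then show ?thesis using \<open>B \<noteq> B'\<close> by simp
qed

lemma no_parents_iff:
  assumes A: "A \<in> W"
  shows "parents A = {} \<longleftrightarrow> A \<in> K"
proof
  assume no: "parents A = {}"
  obtain M where M: "M \<in> K" "A \<subseteq> M"
  proof -
    from A show ?thesis
    proof (cases rule: W_cases)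
      case 1
      from intersection_subset_max_clique[OF this] show ?thesis using that by blast
    next
      case 2
      from vertex_in_max_clique[OF 2(1)] show ?thesis using that 2(2) by auto
    qed
  qed
  have "M \<in> W" by (rule max_clique_in_W[OF M(1)])
  have "\<not> A \<subset> M"
  proof
    assume "A \<subset> M"
    from cover_arc_below[OF finite_W \<open>M \<in> W\<close> A this] show False using no by blast
  qed
  then show "A \<in> K" using M by (simp add: psubset_eq)
next
  assume AK: "A \<in> K"
  have "\<not> A \<subset> B" if "B \<in> W" for B
  proof
    assume "A \<subset> B"
    obtain x y where "x \<in> B" "y \<in> B" "x \<noteq> y"
      using \<open>A \<subset> B\<close> W_nonempty[OF max_clique_in_W[OF AK]] by blast
    then have "B \<in> C" using W_two_elements_in_C[OF \<open>B \<in> W\<close>] by blast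
    from intersection_subset_max_clique[OF this] obtain M where "M \<in> K" "B \<subseteq> M" ..
    then show False using max_clique_antichain[OF AK] \<open>A \<subset> B\<close> by blast
  qed
  then show "parents A = {}" by (auto simp: cover_arc_iff)
qed

lemma max_clique_not_singleton: "{x} \<notin> K"
  using max_clique_card[of "{x}"] by auto

lemma parents_singleton: "x \<in> pverts G \<Longrightarrow> parents {x} \<noteq> {}"
  using no_parents_iff[OF singleton_in_W] max_clique_not_singleton by blast

lemma split_leaves_iff:
  "A \<in> split_leaves \<longleftrightarrow> A \<in> W \<and> card (children A) = 0 \<and> 2 \<le> card (parents A)"
proof
  assume "A \<in> split_leaves"
  then show "A \<in> W \<and> card (children A) = 0 \<and> 2 \<le> card (parents A)"
    using children_singleton singleton_in_W by (auto simp: split_leaves_def)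
next
  assume A: "A \<in> W \<and> card (children A) = 0 \<and> 2 \<le> card (parents A)"
  then have "\<not> 2 \<le> card A" using two_children[of A] by linarith
  then obtain x where "x \<in> pverts G" "A = {x}" using W_singleton_or_card[of A] A by blast
  then show "A \<in> split_leaves" using A by (auto simp: split_leaves_def)
qed

lemma net_verts: "pverts net = Inl ` W \<union> Inr ` split_leaves"
  and net_arcs: "parcs net = map_prod Inl Inl ` parcs (cover_digraph W) \<union> {(Inl A, Inr A) | A. A \<in> split_leaves}"
proof -
  have empty: "{} \<notin> C" using intersection_nonempty by blast
  have eq: "add_singletons (pverts G) C = cover_digraph W"
    unfolding W_def by (rule add_singletons_eq_cover_digraph[OF finite_intersections empty])
  have "{v \<in> pverts (cover_digraph W). out_degree (with_proj (cover_digraph W)) v = 0 \<and>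
      2 \<le> in_degree (with_proj (cover_digraph W)) v} = split_leaves"
    unfolding in_degree_with_proj out_degree_with_proj
    by (rule set_eqI) (simp add: split_leaves_iff cover_digraph_def[of W, THEN arg_cong[where f = pverts]])
  then show "pverts net = Inl ` W \<union> Inr ` split_leaves"
    "parcs net = map_prod Inl Inl ` parcs (cover_digraph W) \<union> {(Inl A, Inr A) | A. A \<in> split_leaves}"
    by (simp_all add: net_def add_children_def eq Let_def cover_digraph_def[of W, THEN arg_cong[where f = pverts]])
qed

lemma net_arc_simps:
  "(Inl A, Inl B) \<in> parcs net \<longleftrightarrow> (A, B) \<in> parcs (cover_digraph W)"
  "(Inl A, Inr B) \<in> parcs net \<longleftrightarrow> A = B \<and> A \<in> split_leaves"
  "(Inr A, v) \<notin> parcs net"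
  by (auto simp: net_arcs)

lemma split_leaves_subset: "split_leaves \<subseteq> W"
  using singleton_in_W by (auto simp: split_leaves_def)

lemma net_pair_digraph: "pair_digraph net"
proof
  show fin: "finite (pverts net)" unfolding net_verts
    using finite_W finite_subset[OF split_leaves_subset finite_W] by simp
  have "parcs net \<subseteq> pverts net \<times> pverts net"
    using split_leaves_subset unfolding net_arcs net_verts by (auto simp: cover_arc_iff)
  then show "finite (parcs net)" by (rule finite_subset) (intro finite_cartesian_product fin)
  show "fst e \<in> pverts net" "snd e \<in> pverts net" if "e \<in> parcs net" for e
    using that split_leaves_subset unfolding net_arcs net_verts by (auto simp: cover_arc_iff)
  show "fst e \<noteq> snd e" if "e \<in> parcs net" for e
    using that unfolding net_arcs by (auto simp: cover_arc_iff)
qed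

lemma net_wf: "pair_wf_digraph net"
  using net_pair_digraph by (simp add: pair_digraph_def pair_fin_digraph_def)

lemma net_subset: "parcs net \<subseteq> pverts net \<times> pverts net"
  using net_wf by (auto dest: pair_wf_digraph.wellformed')

lemma net_in_Inl: "in_degree (with_proj net) (Inl A) = card (parents A)"
proof -
  have "{u. (u, Inl A) \<in> parcs net} = Inl ` parents A" by (auto simp: net_arcs)
  then show ?thesis by (simp add: in_degree_with_proj card_image)
qed

lemma net_in_Inr: "A \<in> split_leaves \<Longrightarrow> in_degree (with_proj net) (Inr A) = 1"
proof -
  assume "A \<in> split_leaves"
  then have "{u. (u, Inr A) \<in> parcs net} = {Inl A}" by (auto simp: net_arcs)
  then show ?thesis by (simp add: in_degree_with_proj)
qed

lemma net_out_Inr: "out_degree (with_proj net) (Inr A) = 0"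
  by (simp add: out_degree_with_proj net_arc_simps)

lemma net_out_Inl:
  "out_degree (with_proj net) (Inl A) = card (children A) + (if A \<in> split_leaves then 1 else 0)"
proof -
  have "{v. (Inl A, v) \<in> parcs net} = Inl ` children A \<union> (if A \<in> split_leaves then {Inr A} else {})"
    by (auto simp: net_arcs)
  moreover have "card (Inl ` children A \<union> (if A \<in> split_leaves then {Inr A} else {})) =
    card (children A) + (if A \<in> split_leaves then 1 else 0)"
    using finite_children by (auto simp: card_image card_insert_if)
  ultimately show ?thesis by (simp add: out_degree_with_proj)
qed

lemma net_leaves: "leaves net = leaf ` pverts G"
proof (intro equalityI subsetI)
  fix v assume v: "v \<in> leaves net"
  then have deg: "in_degree (with_proj net) v = 1" "out_degree (with_proj net) v = 0" and "v \<in> pverts net"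
    by (auto simp: leaves_def)
  then consider A where "v = Inl A" "A \<in> W" | A where "v = Inr A" "A \<in> split_leaves"
    unfolding net_verts by blast
  then show "v \<in> leaf ` pverts G"
  proof cases
    case 1
    then have A: "A \<notin> split_leaves" "card (children A) = 0"
      using deg by (auto simp: net_out_Inl split: if_splits)
    then have "\<not> 2 \<le> card A" using two_children[of A] 1 by linarith
    then obtain x where "x \<in> pverts G" "A = {x}" using W_singleton_or_card 1 by blast
    then show ?thesis using A 1 by (auto simp: leaf_def)
  next
    case 2
    then obtain x where "x \<in> pverts G" "A = {x}" by (auto simp: split_leaves_def)
    then show ?thesis using 2 by (auto simp: leaf_def)
  qed
next
  fix v assume "v \<in> leaf ` pverts G"
  then obtain x where x: "x \<in> pverts G" "v = leaf x" by blast
  show "v \<in> leaves net"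
  proof (cases "{x} \<in> split_leaves")
    case True
    then show ?thesis using x by (auto simp: leaf_def leaves_def net_verts net_in_Inr net_out_Inr)
  next
    case False
    then have "\<not> 2 \<le> card (parents {x})" using x by (auto simp: split_leaves_def)
    moreover have "card (parents {x}) \<noteq> 0" using parents_singleton[OF x(1)] finite_parents by simp
    ultimately have "card (parents {x}) = 1" by linarith
    then have "in_degree (with_proj net) (Inl {x}) = 1" "out_degree (with_proj net) (Inl {x}) = 0"
      unfolding net_in_Inl net_out_Inl children_singleton using False by simp_all
    then show ?thesis using x False singleton_in_W by (simp add: leaf_def leaves_def net_verts)
  qed
qed

lemma leaf_inj: "inj_on leaf (pverts G)"
  by (auto simp: inj_on_def leaf_def split: if_splits)

lemma leaf_in_verts: "x \<in> pverts G \<Longrightarrow> leaf x \<in> pverts net"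
  using singleton_in_W by (auto simp: leaf_def net_verts)

lemma net_nonempty: "pverts net \<noteq> {}"
proof -
  have "pverts G \<noteq> {}" using card_verts by auto
  then show ?thesis using leaf_in_verts by blast
qed

lemma net_roots: "roots net = Inl ` K"
proof -
  have "K \<subseteq> W" using max_clique_in_W by blast
  have "v \<in> roots net \<longleftrightarrow> v \<in> Inl ` K" for v
  proof (cases v)
    case (Inl A)
    have "v \<in> roots net \<longleftrightarrow> A \<in> W \<and> parents A = {}"
      using Inl finite_parents by (auto simp: roots_def net_verts net_in_Inl)
    then show ?thesis using no_parents_iff[of A] \<open>K \<subseteq> W\<close> Inl by blast
  next
    case (Inr A)
    then show ?thesis using net_in_Inr[of A] by (auto simp: roots_def net_verts)
  qed
  then show ?thesis by blast
qed

lemma net_acyclic: "acyclic (parcs net)"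
proof (rule acyclic_subset)
  let ?m = "case_sum (\<lambda>A. Suc (card A)) (\<lambda>_. 0)"
  show "acyclic ((measure ?m)\<inverse>)" by (simp add: wf_acyclic)
  have "card B < card A" if "(A, B) \<in> parcs (cover_digraph W)" for A B
    using that W_finite by (intro psubset_card_mono) (simp_all add: cover_arc_iff)
  then show "parcs net \<subseteq> (measure ?m)\<inverse>" by (auto simp: net_arcs)
qed

lemma net_reach_leaf:
  assumes "A \<in> W" "x \<in> pverts G"
  shows "(Inl A, leaf x) \<in> (parcs net)\<^sup>* \<longleftrightarrow> x \<in> A"
proof
  have "\<exists>B. (v = Inl B \<or> v = Inr B) \<and> B \<subseteq> A" if "(Inl A, v) \<in> (parcs net)\<^sup>*" for v
    using that
  proof (induction rule: rtrancl_induct)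
    case (step v w)
    then obtain B where B: "v = Inl B \<or> v = Inr B" "B \<subseteq> A" by blast
    then have v: "v = Inl B" using step(2) net_arc_simps(3) by blast
    show ?case
    proof (cases w)
      case (Inl D)
      then have "D \<subseteq> B" using step(2) v by (simp add: net_arc_simps cover_arc_iff psubset_imp_subset)
      then show ?thesis using Inl B(2) by blast
    next
      case (Inr D)
      then have "D = B" using step(2) v by (simp add: net_arc_simps)
      then show ?thesis using Inr B(2) by blast
    qed
  qed auto
  then show "x \<in> A" if "(Inl A, leaf x) \<in> (parcs net)\<^sup>*"
    using that by (auto simp: leaf_def split: if_splits)
next
  assume "x \<in> A"
  have "(A, {x}) \<in> (parcs (cover_digraph W))\<^sup>*"
    using cover_rtrancl_iff[OF finite_W W_finite assms(1) singleton_in_W[OF assms(2)]] \<open>x \<in> A\<close> by simp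
  then have "(Inl A, Inl {x}) \<in> (map_prod Inl Inl ` parcs (cover_digraph W))\<^sup>*"
    by (rule rtrancl_map_prod_imageI)
  then have "(Inl A, Inl {x}) \<in> (parcs net)\<^sup>*"
    by (rule rtrancl_mono[THEN subsetD, rotated]) (simp add: net_arcs)
  then show "(Inl A, leaf x) \<in> (parcs net)\<^sup>*"
    by (auto simp: leaf_def net_arc_simps intro: rtrancl_into_rtrancl)
qed

lemma net_share_iff:
  assumes "x \<in> pverts G" "y \<in> pverts G" "x \<noteq> y"
  shows "share (parcs net) (leaf x) (leaf y) \<longleftrightarrow> (x, y) \<in> parcs G"
proof
  assume "share (parcs net) (leaf x) (leaf y)"
  then obtain w where w: "(w, leaf x) \<in> (parcs net)\<^sup>*" "(w, leaf y) \<in> (parcs net)\<^sup>*"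
    by (auto simp: share_def)
  have "leaf x \<noteq> leaf y" using leaf_inj assms by (auto dest: inj_onD)
  have "w \<in> pverts net"
    using w(1) leaf_in_verts[OF assms(1)] net_subset by (auto elim: converse_rtranclE)
  have "w \<noteq> Inr A" for A
  proof
    assume "w = Inr A"
    then have "v = w" if "(w, v) \<in> (parcs net)\<^sup>*" for v
      using that by (auto elim: converse_rtranclE simp: net_arc_simps)
    then show False using w \<open>leaf x \<noteq> leaf y\<close> by metis
  qed
  then obtain A where A: "w = Inl A" "A \<in> W" using \<open>w \<in> pverts net\<close> unfolding net_verts by blast
  then have xy: "x \<in> A" "y \<in> A" using w net_reach_leaf assms by auto
  then have "A \<in> C" using W_two_elements_in_C[OF A(2)] assms(3) by blast
  from intersection_subset_max_clique[OF this] obtain M where "M \<in> K" "A \<subseteq> M" ..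
  then show "(x, y) \<in> parcs G" using max_clique_adjacent xy assms(3) by blast
next
  assume "(x, y) \<in> parcs G"
  from arc_in_max_clique[OF this] obtain M where M: "M \<in> K" "x \<in> M" "y \<in> M" by blast
  then have "M \<in> W" using max_clique_in_W by blast
  then show "share (parcs net) (leaf x) (leaf y)"
    using net_reach_leaf M assms unfolding share_def by blast
qed

lemma net_connected:
  assumes "u \<in> pverts net" "v \<in> pverts net"
  shows "(u, v) \<in> (symcl (parcs net))\<^sup>*"
proof -
  let ?S = "(symcl (parcs net))\<^sup>*"
  have "sym (symcl (parcs net))" by (auto simp: sym_def)
  then have sym: "(a, b) \<in> ?S \<Longrightarrow> (b, a) \<in> ?S" for a b by (meson sym_rtrancl symD)
  have "parcs net \<subseteq> symcl (parcs net)" by (auto simp: symcl_def)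
  then have sub: "(a, b) \<in> (parcs net)\<^sup>* \<Longrightarrow> (a, b) \<in> ?S" for a b by (meson rtrancl_mono subsetD)
  have to_leaf: "\<exists>x\<in>pverts G. (w, leaf x) \<in> ?S" if w: "w \<in> pverts net" for w
  proof (cases w)
    case (Inl A)
    then have A: "A \<in> W" using w unfolding net_verts by blast
    obtain x where x: "x \<in> A" using W_nonempty[OF A] by blast
    then have xG: "x \<in> pverts G" using W_subset[OF A] by blast
    have "(w, leaf x) \<in> (parcs net)\<^sup>*" using net_reach_leaf[OF A xG] x Inl by simp
    then show ?thesis using sub xG by blast
  next
    case (Inr A)
    then have "A \<in> split_leaves" using w unfolding net_verts by blast
    then obtain x where "x \<in> pverts G" "A = {x}" by (auto simp: split_leaves_def)
    then have "w = leaf x" using Inr \<open>A \<in> split_leaves\<close> by (simp add: leaf_def)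
    then show ?thesis using \<open>x \<in> pverts G\<close> by blast
  qed
  have arc: "(leaf x, leaf y) \<in> ?S" if xy: "(x, y) \<in> parcs G" for x y
  proof -
    have "x \<in> pverts G" "y \<in> pverts G" "x \<noteq> y" using xy in_arcsD1 in_arcsD2 no_loops' by blast+
    then obtain w where "(w, leaf x) \<in> (parcs net)\<^sup>*" "(w, leaf y) \<in> (parcs net)\<^sup>*"
      using net_share_iff xy unfolding share_def by blast
    then show ?thesis using sub sym by (meson rtrancl_trans)
  qed
  have leaves: "(leaf x, leaf y) \<in> ?S" if "(x, y) \<in> (parcs G)\<^sup>*" for x y
    using that
  proof (induction rule: rtrancl_induct)
    case (step y z)
    then show ?case using arc[of y z] by (meson rtrancl_trans)
  qed simp
  obtain x where x: "x \<in> pverts G" "(u, leaf x) \<in> ?S" using to_leaf[OF assms(1)] by blast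
  obtain y where y: "y \<in> pverts G" "(v, leaf y) \<in> ?S" using to_leaf[OF assms(2)] by blast
  have "(leaf x, leaf y) \<in> ?S" using leaves rtrancl_parcs x(1) y(1) by blast
  then show ?thesis using x(2) sym[OF y(2)] by (meson rtrancl_trans)
qed

lemma parents_new_singleton:
  assumes "x \<in> pverts G" "{x} \<notin> C" "A \<in> parents {x}"
  shows "A = \<Inter>{M \<in> K. x \<in> M}"
proof -
  let ?A = "\<Inter>{M \<in> K. x \<in> M}"
  have "{M \<in> K. x \<in> M} \<noteq> {}" using vertex_in_max_clique[OF assms(1)] by blast
  then have AC: "?A \<in> C" unfolding intersections_def by blast
  then have "{x} \<noteq> ?A" using assms(2) by metis
  moreover have "{x} \<subseteq> ?A" by simp
  ultimately have sub: "{x} \<subset> ?A" by (simp add: psubset_eq)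
  have A: "A \<in> W" "{x} \<subset> A" "\<And>D. D \<in> W \<Longrightarrow> {x} \<subset> D \<Longrightarrow> \<not> D \<subset> A"
    using assms(3) by (auto simp: cover_arc_iff)
  obtain y where "y \<in> A" "y \<noteq> x" using A(2) by blast
  then have "A \<in> C" using W_two_elements_in_C[OF A(1)] A(2) by blast
  then have "?A \<subseteq> A" using A(2) unfolding intersections_def by blast
  moreover have "\<not> ?A \<subset> A" using A(3)[OF intersection_in_W[OF AC] sub] .
  ultimately show ?thesis by blast
qed

lemma net_undirected_acyclic:
  assumes acyc: "\<not> (\<exists>xs. rel_cycle (symcl (parcs (cover_digraph C))) xs)"
  shows "\<not> (\<exists>xs. rel_cycle (symcl (parcs net)) xs)"
proof
  assume "\<exists>xs. rel_cycle (symcl (parcs net)) xs"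
  then obtain xs where xs: "rel_cycle (symcl (parcs net)) xs" by blast
  have in_C: "\<exists>A\<in>C. v = Inl A" if v: "v \<in> set xs" for v
  proof -
    from rel_cycle_two_neighbours[OF xs v] obtain a b
      where ab: "a \<noteq> b" "(a, v) \<in> symcl (parcs net)" "(v, b) \<in> symcl (parcs net)" by blast
    show ?thesis
    proof (cases v)
      case (Inr A)
      then have "a = Inl A" "b = Inl A" using ab by (auto simp: net_arcs)
      then show ?thesis using ab(1) by simp
    next
      case (Inl A)
      show ?thesis
      proof (cases "A \<in> C")
        case False
        have "A \<in> W" using Inl ab(2) net_subset unfolding symcl_iff net_verts by blast
        then obtain x where x: "x \<in> pverts G" "A = {x}" using False by (auto elim: W_cases)
        have only: "parents A \<subseteq> {\<Inter>{M \<in> K. x \<in> M}}"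
          using parents_new_singleton[OF x(1)] False x(2) by blast
        then have "card (parents A) \<le> card {\<Inter>{M \<in> K. x \<in> M}}" by (intro card_mono) simp_all
        then have "A \<notin> split_leaves" by (simp add: split_leaves_iff)
        have "w = Inl (\<Inter>{M \<in> K. x \<in> M})" if w: "(w, v) \<in> symcl (parcs net)" for w
        proof -
          have "(v, w) \<notin> parcs net"
          proof
            assume vw: "(v, w) \<in> parcs net"
            then obtain B where "w = Inl B" using \<open>A \<notin> split_leaves\<close> Inl by (cases w) (auto simp: net_arc_simps)
            then have "B \<in> children {x}" using vw Inl x by (simp add: net_arc_simps)
            then show False by (simp only: children_singleton empty_iff)
          qed
          then have wv: "(w, v) \<in> parcs net" using w by simp
          then obtain B where "w = Inl B" using Inl by (cases w) (auto simp: net_arc_simps)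
          then show ?thesis using wv only Inl by (auto simp: net_arc_simps)
        qed
        then show ?thesis using ab by (metis symcl_iff)
      qed (use Inl in blast)
    qed
  qed
  have "rel_cycle (symcl (parcs (cover_digraph C))) (map projl xs)"
  proof (rule rel_cycle_map[OF xs])
    show "inj_on projl (set xs)" using in_C by (intro inj_onI) (metis sum.sel(1))
    fix a b assume ab: "a \<in> set xs" "b \<in> set xs" "(a, b) \<in> symcl (parcs net)"
    obtain A B where AB: "A \<in> C" "a = Inl A" "B \<in> C" "b = Inl B" using in_C ab by metis
    then have "(A, B) \<in> parcs (cover_digraph W) \<or> (B, A) \<in> parcs (cover_digraph W)"
      using ab(3) by (simp add: net_arc_simps)
    then have "(A, B) \<in> parcs (cover_digraph C) \<or> (B, A) \<in> parcs (cover_digraph C)"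
      using AB intersection_in_W by (auto simp: cover_arc_iff)
    then show "(projl a, projl b) \<in> symcl (parcs (cover_digraph C))" using AB by simp
  qed
  then show False using acyc by blast
qed

lemma rename_net_arboreal:
  assumes f: "inj_on f (pverts net)"
    and acyc: "\<not> (\<exists>xs. rel_cycle (symcl (parcs (cover_digraph C))) xs)"
  shows "arboreal (rename f net)"
proof -
  have wf: "pair_wf_digraph (rename f net)"
    using pair_digraph_rename[OF f net_pair_digraph] by (simp add: pair_digraph_def pair_fin_digraph_def)
  have sub: "symcl (parcs net) \<subseteq> pverts net \<times> pverts net"
    using net_subset by (auto simp: symcl_def)
  have "\<not> (\<exists>xs. rel_cycle (symcl (parcs (rename f net))) xs)"
    using net_undirected_acyclic[OF acyc] rel_cycle_in_rename[OF f sub]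
    by (auto simp: symcl_map_prod_image)
  moreover have "(a, b) \<in> (symcl (parcs (rename f net)))\<^sup>*"
    if "a \<in> pverts (rename f net)" "b \<in> pverts (rename f net)" for a b
    using that net_connected by (auto simp: symcl_map_prod_image intro!: rtrancl_map_prod_imageI)
  ultimately show ?thesis
    using net_nonempty unfolding arboreal_def undirected_tree_def connected_iff_rtrancl[OF wf]
      undirected_acyclic_iff[OF wf] by simp
qed

lemma rename_net_network:
  assumes f: "inj_on f (pverts net)" and leaf: "\<And>x. x \<in> pverts G \<Longrightarrow> f (leaf x) = Inl x"
  shows "network_on (pverts G) (rename f net)"
proof -
  have pd: "pair_digraph (rename f net)" by (rule pair_digraph_rename[OF f net_pair_digraph])
  then have wf: "pair_wf_digraph (rename f net)" by (simp add: pair_digraph_def pair_fin_digraph_def)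
  note deg = in_degree_rename[OF f net_wf] out_degree_rename[OF f net_wf]
  have conn: "Digraph_Component.connected (with_proj (rename f net))"
    unfolding connected_iff_rtrancl[OF wf]
    using net_nonempty net_connected by (auto simp: symcl_map_prod_image intro!: rtrancl_map_prod_imageI)
  have "leaves (rename f net) = f ` leaves net"
    unfolding leaves_def using deg by auto
  then have lv: "leaves (rename f net) = Inl ` pverts G"
    using leaf by (auto simp: net_leaves image_image)
  have net: "(in_degree (with_proj net) v = 0 \<longrightarrow> 2 \<le> out_degree (with_proj net) v) \<and>
    (out_degree (with_proj net) v = 0 \<longrightarrow> in_degree (with_proj net) v = 1) \<and>
    \<not> (in_degree (with_proj net) v = 1 \<and> out_degree (with_proj net) v = 1)" if v: "v \<in> pverts net" for v
  proof (cases v)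
    case (Inr A)
    then have "A \<in> split_leaves" using v unfolding net_verts by blast
    then show ?thesis using Inr by (simp add: net_in_Inr net_out_Inr)
  next
    case (Inl A)
    then have A: "A \<in> W" using v unfolding net_verts by blast
    from W_singleton_or_card[OF A] show ?thesis
    proof
      assume "2 \<le> card A"
      from two_children[OF A this] show ?thesis using Inl by (simp add: net_out_Inl)
    next
      assume "\<exists>x\<in>pverts G. A = {x}"
      then obtain x where x: "x \<in> pverts G" "A = {x}" by blast
      have "card (parents A) \<noteq> 0" using parents_singleton[OF x(1)] finite_parents x(2) by simp
      moreover have "2 \<le> card (parents A) \<longleftrightarrow> A \<in> split_leaves" using x by (auto simp: split_leaves_def)
      moreover have "card (children A) = 0" unfolding x(2) children_singleton by simp
      ultimately show ?thesis using Inl by (auto simp: net_in_Inl net_out_Inl)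
    qed
  qed
  show ?thesis
    unfolding network_on_def
    using pd conn lv net deg acyclic_map_prod_image[OF f net_subset net_acyclic] by auto
qed

lemma rename_net_represents:
  assumes f: "inj_on f (pverts net)" and leaf: "\<And>x. x \<in> pverts G \<Longrightarrow> f (leaf x) = Inl x"
  shows "represents (pverts G) (rename f net) G"
proof -
  have wf: "pair_wf_digraph (rename f net)"
    using pair_digraph_rename[OF f net_pair_digraph] by (simp add: pair_digraph_def pair_fin_digraph_def)
  have share: "share_ancestor (rename f net) (Inl x) (Inl y) \<longleftrightarrow> (x, y) \<in> parcs G"
    if xy: "x \<in> pverts G" "y \<in> pverts G" "x \<noteq> y" for x y
  proof -
    have V: "leaf x \<in> pverts net" "leaf y \<in> pverts net" using leaf_in_verts xy by auto
    have "share_ancestor (rename f net) (f (leaf x)) (f (leaf y)) \<longleftrightarrow>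
        (\<exists>w\<in>pverts net. (w, leaf x) \<in> (parcs net)\<^sup>* \<and> (w, leaf y) \<in> (parcs net)\<^sup>*)"
      unfolding share_ancestor_def reachable_iff_rtrancl[OF wf]
      using rtrancl_map_prod_image_iff[OF f net_subset] V by auto
    also have "\<dots> \<longleftrightarrow> share_ancestor net (leaf x) (leaf y)"
      unfolding share_ancestor_def reachable_iff_rtrancl[OF net_wf] by auto
    also have "\<dots> \<longleftrightarrow> (x, y) \<in> parcs G"
      using share_ancestor_iff_share[OF net_wf V(1)] net_share_iff[OF xy] by simp
    finally show ?thesis using leaf xy by simp
  qed
  have arc: "x \<in> pverts G \<and> y \<in> pverts G \<and> x \<noteq> y" if "(x, y) \<in> parcs G" for x y
    using in_arcsD1[OF that] in_arcsD2[OF that] no_loops'[OF that] by simp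
  show ?thesis
    unfolding represents_def shared_ancestry_graph_def
  proof (rule pair_pre_digraph.equality)
    show "parcs \<lparr>pverts = pverts G, parcs = {(x, y). x \<in> pverts G \<and> y \<in> pverts G \<and> x \<noteq> y \<and>
        share_ancestor (rename f net) (Inl x) (Inl y)}\<rparr> = parcs G"
      using share by (auto dest: arc)
  qed simp_all
qed

lemma rename_net_roots:
  assumes f: "inj_on f (pverts net)"
  shows "card (roots (rename f net)) = card K"
proof -
  have "roots (rename f net) = f ` roots net"
    unfolding roots_def using in_degree_rename[OF f net_wf] by auto
  moreover have "roots net \<subseteq> pverts net" by (auto simp: roots_def)
  ultimately have "card (roots (rename f net)) = card (roots net)"
    using card_image inj_on_subset[OF f] by metis
  then show ?thesis by (simp add: net_roots card_image)
qed

lemma clique_network_eq: "clique_network (pverts G) K = rename (leaf_label (pverts G) net) net"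
  by (simp add: clique_network_def set_network_def identify_leaves_def rename_def net_def)

lemma leaf_label_leaf:
  assumes x: "x \<in> pverts G"
  shows "leaf_label (pverts G) net (leaf x) = Inl x"
proof -
  have "leaf x \<in> leaves net" using x by (simp add: net_leaves)
  moreover have "(THE y. y \<in> pverts G \<and> (leaf x = Inl {y} \<or> (Inl {y}, leaf x) \<in> parcs net)) = x"
  proof (rule the_equality)
    show "x \<in> pverts G \<and> (leaf x = Inl {x} \<or> (Inl {x}, leaf x) \<in> parcs net)"
      using x by (simp add: leaf_def net_arc_simps)
    fix y assume y: "y \<in> pverts G \<and> (leaf x = Inl {y} \<or> (Inl {y}, leaf x) \<in> parcs net)"
    show "y = x"
    proof (cases "{x} \<in> split_leaves")
      case True
      then show ?thesis using y by (simp add: leaf_def net_arc_simps)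
    next
      case False
      have "{x} \<notin> children {y}" by (simp only: children_singleton empty_iff not_False_eq_True)
      then show ?thesis using y False by (simp add: leaf_def net_arc_simps)
    qed
  qed
  ultimately show ?thesis by (simp add: leaf_label_def)
qed

lemma leaf_label_other:
  assumes "v \<in> pverts net" "v \<notin> leaf ` pverts G"
  shows "\<exists>A. v = Inl A \<and> leaf_label (pverts G) net v = Inr A"
proof (cases v)
  case (Inl A)
  then show ?thesis using assms by (simp add: leaf_label_def net_leaves)
next
  case (Inr A)
  then have "A \<in> split_leaves" using assms(1) unfolding net_verts by blast
  then obtain x where "x \<in> pverts G" "A = {x}" by (auto simp: split_leaves_def)
  then have "v = leaf x" using Inr \<open>A \<in> split_leaves\<close> by (simp add: leaf_def)
  then show ?thesis using assms(2) \<open>x \<in> pverts G\<close> by blast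
qed

lemma leaf_label_inj: "inj_on (leaf_label (pverts G) net) (pverts net)"
proof (rule inj_onI)
  fix u v assume V: "u \<in> pverts net" "v \<in> pverts net"
    and eq: "leaf_label (pverts G) net u = leaf_label (pverts G) net v"
  show "u = v"
  proof (cases "u \<in> leaf ` pverts G")
    case True
    then obtain x where x: "x \<in> pverts G" "u = leaf x" by blast
    then have "leaf_label (pverts G) net v = Inl x" using eq leaf_label_leaf by simp
    then have "v \<in> leaf ` pverts G" using leaf_label_other[OF V(2)] by auto
    then obtain y where y: "y \<in> pverts G" "v = leaf y" by blast
    then show ?thesis using x eq leaf_label_leaf by simp
  next
    case False
    from leaf_label_other[OF V(1) this] obtain A
      where A: "u = Inl A" "leaf_label (pverts G) net u = Inr A" by blast
    have "v \<notin> leaf ` pverts G" using A(2) eq leaf_label_leaf by auto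
    from leaf_label_other[OF V(2) this] obtain B
      where "v = Inl B" "leaf_label (pverts G) net v = Inr B" by blast
    then show ?thesis using A eq by simp
  qed
qed

lemma nat_label_ex:
  "\<exists>f :: 'a set + 'a set \<Rightarrow> 'a + nat. inj_on f (pverts net) \<and> (\<forall>x\<in>pverts G. f (leaf x) = Inl x)"
proof -
  let ?l = "leaf_label (pverts G) net"
  have "finite (pverts net)" using net_pair_digraph by (rule pair_digraph.axioms(1)[THEN pair_fin_digraph.pair_finite_verts])
  then have "finite (Inr -` (?l ` pverts net))" by (intro finite_vimageI) simp_all
  from finite_imp_inj_to_nat_seg[OF this]
  obtain g :: "'a set \<Rightarrow> nat" where g: "inj_on g (Inr -` (?l ` pverts net))"
    by (elim exE conjE)
  have "inj_on (map_sum id g) (?l ` pverts net)"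
  proof (rule inj_onI)
    fix a b assume ab: "a \<in> ?l ` pverts net" "b \<in> ?l ` pverts net" "map_sum id g a = map_sum id g b"
    show "a = b"
    proof (cases a; cases b)
      fix A B assume AB: "a = Inr A" "b = Inr B"
      then have "A = B" using ab inj_onD[OF g, of A B] by simp
      then show ?thesis using AB by simp
    qed (use ab in simp_all)
  qed
  then have "inj_on (map_sum id g \<circ> ?l) (pverts net)" by (rule comp_inj_on[OF leaf_label_inj])
  moreover have "(map_sum id g \<circ> ?l) (leaf x) = Inl x" if "x \<in> pverts G" for x
    using leaf_label_leaf[OF that] by simp
  ultimately show ?thesis by blast
qed

theorem arboreal_clique_network:
  assumes "\<not> (\<exists>xs. rel_cycle (symcl (parcs (cover_digraph C))) xs)"
  shows "arboreal (clique_network (pverts G) K)"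
  unfolding clique_network_eq by (rule rename_net_arboreal[OF leaf_label_inj assms])

end

theorem theorem6p4:
  fixes G :: "'a pair_pre_digraph" and X :: "'a set"
  assumes "pair_graph G"
    and "Digraph_Component.connected (with_proj G)"
    and "pverts G = X"
    and "2 \<le> card X"
  shows "(ptolemaic G \<longleftrightarrow> undirected_acyclic (clique_cover_digraph (max_cliques G))) \<and>
    (ptolemaic G \<longleftrightarrow> arboreal (clique_network X (max_cliques G))) \<and>
    (ptolemaic G \<longleftrightarrow> arboreal_representable X G) \<and>
    (ptolemaic G \<longleftrightarrow>
      (\<exists>N :: ('a + nat) pair_pre_digraph.
        network_on X N \<and> arboreal N \<and> represents X N G \<and>
        card (roots N) = ecc G \<and> ecc G = card (max_cliques G)))"
proof -
  interpret connected_pair_graph G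
    using assms by (simp add: connected_pair_graph_def connected_pair_graph_axioms_def)
  let ?K = "max_cliques G"
  let ?H = "cover_digraph (intersections ?K)"
  have wf_H: "pair_wf_digraph ?H" by unfold_locales (auto simp: cover_digraph_def)
  have acyclic_iff: "undirected_acyclic (clique_cover_digraph ?K) \<longleftrightarrow>
      \<not> (\<exists>xs. rel_cycle (symcl (parcs ?H)) xs)"
    unfolding clique_cover_digraph_def by (rule undirected_acyclic_iff[OF wf_H])
  have i_ii: "undirected_acyclic (clique_cover_digraph ?K)" if "ptolemaic G"
  proof -
    interpret ptolemaic_pair_graph G by unfold_locales fact
    show ?thesis unfolding acyclic_iff by (rule cover_digraph_acyclic)
  qed
  have ii_iii: "arboreal (clique_network X ?K)" if "undirected_acyclic (clique_cover_digraph ?K)"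
    using arboreal_clique_network that unfolding acyclic_iff assms(3) by blast
  have iii_i: "ptolemaic G" if "arboreal (clique_network X ?K)"
  proof (rule ptolemaic_of_arboreal_network[OF assms(1-3)])
    show "arboreal (clique_network X ?K)" by fact
    show "network_on X (clique_network X ?K)" "represents X (clique_network X ?K) G"
      using rename_net_network[OF leaf_label_inj leaf_label_leaf]
        rename_net_represents[OF leaf_label_inj leaf_label_leaf]
      unfolding clique_network_eq assms(3)[symmetric] by blast+
  qed
  have iv_i: "ptolemaic G" if "arboreal_representable X G"
    using that ptolemaic_of_arboreal_network[OF assms(1-3)] unfolding arboreal_representable_def by blast
  have i_v: "\<exists>N :: ('a + nat) pair_pre_digraph. network_on X N \<and> arboreal N \<and> represents X N G \<and>
      card (roots N) = ecc G \<and> ecc G = card ?K" if "ptolemaic G"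
  proof -
    interpret ptolemaic_pair_graph G by unfold_locales fact
    obtain f :: "'a set + 'a set \<Rightarrow> 'a + nat"
      where f: "inj_on f (pverts net)" and leaf: "\<And>x. x \<in> pverts G \<Longrightarrow> f (leaf x) = Inl x"
      using nat_label_ex by blast
    show ?thesis
      using rename_net_network[OF f leaf] rename_net_arboreal[OF f cover_digraph_acyclic]
        rename_net_represents[OF f leaf] rename_net_roots[OF f] ecc_eq_card_max_cliques
      unfolding assms(3) by (intro exI[of _ "rename f net"]) simp
  qed
  then have i_iv: "arboreal_representable X G" if "ptolemaic G"
    using that unfolding arboreal_representable_def by blast
  have v_iv: "arboreal_representable X G"
    if "\<exists>N :: ('a + nat) pair_pre_digraph. network_on X N \<and> arboreal N \<and> represents X N G \<and>
      card (roots N) = ecc G \<and> ecc G = card ?K"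
    using that unfolding arboreal_representable_def by blast
  show ?thesis
    by (intro conjI iffI) (fact i_ii ii_iii iii_i iv_i i_v i_iv | blast intro: i_ii ii_iii iii_i iv_i v_iv)+
qed

end
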